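(* Let $p>1$ and let $\Phi:\mathbb{B}\to\mathbb{B}$ be a slice regular map such that $\Phi(\mathbb{B}_i)\subset\mathbb{B}_i$ for some $i\in\mathbb{S}$; fix such an $i$. Then $C_\Phi:\mathfrak{B}_p\to\mathfrak{B}_p$ is compact if and only if for every bounded sequence $\{f_m\}_{m\in\mathbb{N}}$ in $\mathfrak{B}_p$ with $f_m\to0$ uniformly on compact subsets of $\mathbb{B}$ as $m\to\infty$, one has $\|C_\Phi f_m\|_{\mathfrak{B}_p}\to0$.
   Context: $\mathbb{H}$ is the skew field of quaternions with Euclidean norm $|\cdot|$, $\mathbb{S}=\{q\in\mathbb{H}: q^2=-1\}$ is the sphere of imaginary units, $\mathbb{B}=\{q\in\mathbb{H}:|q|<1\}$. For $i\in\mathbb{S}$, $\mathbb{C}(i)=\mathbb{R}+\mathbb{R}i$ and $\mathbb{B}_i=\mathbb{B}\cap\mathbb{C}(i)$, identified with the unit disk. A real differentiable function $f:\mathbb{B}\to\mathbb{H}$ is (left) slice regular (also called slice holomorphic or slice hyperholomorphic) if for every $i\in\mathbb{S}$ its restriction $f_i$ to $\mathbb{B}_i$ satisfies $\frac{\partial}{\partial x}f_i(x+iy)+i\frac{\partial}{\partial y}f_i(x+iy)=0$. $SR(\mathbb{B})$ denotes the set of such functions. $\frac{\partial f}{\partial x_0}$ is the derivative in the real direction. Besov space: for $p>1$, $\mathfrak{B}_p$ is the space of $f\in SR(\mathbb{B})$ with $\sup_{i\in\mathbb{S}}\int_{\mathbb{B}_i}\left|(1-|q|^2)\frac{\partial f}{\partial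 x_0}(q)\right|^p d\lambda_i(q)<\infty$, where $d\lambda_i(q)=\frac{dA_i(q)}{(1-|q|^2)^2}$ and $dA_i$ is normalized area measure on $\mathbb{B}_i$. It is a Banach space under $$\|f\|_{\mathfrak{B}_p}=|f(0)|+\left(\sup_{i\in\mathbb{S}}\int_{\mathbb{B}_i}\left|(1-|q|^2)\frac{\partial f}{\partial x_0}(q)\right|^p d\lambda_i(q)\right)^{1/p}.$$ Composition operator: if $\Phi:\mathbb{B}\to\mathbb{B}$ is slice regular with $\Phi(\mathbb{B}_i)\subset\mathbb{B}_i$, then $C_\Phi f=f\circ_i\Phi$ is the unique slice regular function on $\mathbb{B}$ whose restriction to $\mathbb{B}_i$ is $f|_{\mathbb{B}_i}\circ\Phi|_{\mathbb{B}_i}$. Explicitly, writing $g=f|_{\mathbb{B}_i}\circ\Phi|_{\mathbb{B}_i}$, for $q=x+I_qy$ with $I_q\in\mathbb{S}$, $(C_\Phi f)(q)=\frac12\left[(1-I_qi)g(x+iy)+(1+I_qi)g(x-iy)\right]$. *)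

theory Defs
  imports "HOL-Analysis.Analysis"
begin

section \<open>The skew field of quaternions\<close>

datatype quat = Quat (qre: real) (qi: real) (qj: real) (qk: real)

lemma quat_eq_iff: "x = y \<longleftrightarrow> qre x = qre y \<and> qi x = qi y \<and> qj x = qj y \<and> qk x = qk y"
  by (cases x; cases y) auto

instantiation quat :: real_vector
begin

definition "0 = Quat 0 0 0 0"
definition "x + y = Quat (qre x + qre y) (qi x + qi y) (qj x + qj y) (qk x + qk y)"
definition "- x = Quat (- qre x) (- qi x) (- qj x) (- qk x)"
definition "x - (y::quat) = x + - y"
definition "r *\<^sub>R x = Quat (r * qre x) (r * qi x) (r * qj x) (r * qk x)"

lemma quat_sel_zero [simp]: "qre 0 = 0" "qi 0 = 0" "qj 0 = 0" "qk 0 = 0"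
  by (simp_all add: zero_quat_def)

lemma quat_sel_add [simp]:
  "qre (x + y) = qre x + qre y" "qi (x + y) = qi x + qi y"
  "qj (x + y) = qj x + qj y" "qk (x + y) = qk x + qk y"
  by (simp_all add: plus_quat_def)

lemma quat_sel_uminus [simp]:
  "qre (- x) = - qre x" "qi (- x) = - qi x" "qj (- x) = - qj x" "qk (- x) = - qk x"
  by (simp_all add: uminus_quat_def)

lemma quat_sel_diff [simp]:
  "qre (x - y) = qre x - qre y" "qi (x - y) = qi x - qi y"
  "qj (x - y) = qj x - qj y" "qk (x - y) = qk x - qk y"
  by (simp_all add: minus_quat_def)

lemma quat_sel_scaleR [simp]:
  "qre (r *\<^sub>R x) = r * qre x" "qi (r *\<^sub>R x) = r * qi x"
  "qj (r *\<^sub>R x) = r * qj x" "qk (r *\<^sub>R x) = r * qk x"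
  by (simp_all add: scaleR_quat_def)

instance
  by standard (simp_all add: quat_eq_iff algebra_simps)

end

instantiation quat :: real_inner
begin

definition "inner x y = qre x * qre y + qi x * qi y + qj x * qj y + qk x * qk y"
definition "norm (x::quat) = sqrt (inner x x)"
definition "sgn (x::quat) = x /\<^sub>R norm x"
definition "dist (x::quat) y = norm (x - y)"
definition [code del]:
  "(uniformity :: (quat \<times> quat) filter) = (INF e\<in>{0 <..}. principal {(x, y). dist x y < e})"
definition [code del]:
  "open (U :: quat set) \<longleftrightarrow> (\<forall>x\<in>U. eventually (\<lambda>(x', y). x' = x \<longrightarrow> y \<in> U) uniformity)"

instance
proof
  fix x y z :: quat and r :: real
  show "inner x y = inner y x" "inner (x + y) z = inner x z + inner y z"
    "inner (r *\<^sub>R x) y = r * inner x y"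
    by (simp_all add: inner_quat_def algebra_simps)
  show "0 \<le> inner x x"
    by (simp add: inner_quat_def)
  show "inner x x = 0 \<longleftrightarrow> x = 0"
    by (simp add: inner_quat_def quat_eq_iff add_nonneg_eq_0_iff)
qed (rule norm_quat_def sgn_quat_def dist_quat_def uniformity_quat_def open_quat_def)+

end

instantiation quat :: euclidean_space
begin

definition "Basis = {Quat 1 0 0 0, Quat 0 1 0 0, Quat 0 0 1 0, Quat 0 0 0 1}"

instance
proof
  show "(Basis :: quat set) \<noteq> {}" "finite (Basis :: quat set)"
    by (simp_all add: Basis_quat_def)
  show "inner u v = (if u = v then 1 else 0)" if "u \<in> Basis" "v \<in> Basis" for u v :: quat
    using that unfolding Basis_quat_def by (elim insertE emptyE; simp add: inner_quat_def)
  show "(\<forall>u\<in>Basis. inner x u = 0) \<longleftrightarrow> x = 0" for x :: quat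
    unfolding Basis_quat_def ball_simps inner_quat_def by (simp add: quat_eq_iff)
qed

end

instantiation quat :: real_normed_div_algebra
begin

definition "1 = Quat 1 0 0 0"

definition "x * y = Quat
  (qre x * qre y - qi x * qi y - qj x * qj y - qk x * qk y)
  (qre x * qi y + qi x * qre y + qj x * qk y - qk x * qj y)
  (qre x * qj y - qi x * qk y + qj x * qre y + qk x * qi y)
  (qre x * qk y + qi x * qj y - qj x * qi y + qk x * qre y)"

definition "inverse x = Quat (qre x) (- qi x) (- qj x) (- qk x) /\<^sub>R (norm x)\<^sup>2"
definition "x div (y::quat) = x * inverse y"

lemma quat_sel_one [simp]: "qre 1 = 1" "qi 1 = 0" "qj 1 = 0" "qk 1 = 0"
  by (simp_all add: one_quat_def)

lemma quat_sel_mult [simp]: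
  "qre (x * y) = qre x * qre y - qi x * qi y - qj x * qj y - qk x * qk y"
  "qi (x * y) = qre x * qi y + qi x * qre y + qj x * qk y - qk x * qj y"
  "qj (x * y) = qre x * qj y - qi x * qk y + qj x * qre y + qk x * qi y"
  "qk (x * y) = qre x * qk y + qi x * qj y - qj x * qi y + qk x * qre y"
  by (simp_all add: times_quat_def)

instance
proof
  fix x y z :: quat and r :: real
  have nrm: "(norm u)\<^sup>2 = (qre u)\<^sup>2 + (qi u)\<^sup>2 + (qj u)\<^sup>2 + (qk u)\<^sup>2" for u :: quat
    unfolding power2_norm_eq_inner by (simp add: inner_quat_def power2_eq_square)
  show "x * y * z = x * (y * z)" "(x + y) * z = x * z + y * z" "x * (y + z) = x * y + x * z"
    "1 * x = x" "x * 1 = x" "r *\<^sub>R x * y = r *\<^sub>R (x * y)" "x * r *\<^sub>R y = r *\<^sub>R (x * y)"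
    by (simp_all add: quat_eq_iff algebra_simps)
  show "(0::quat) \<noteq> 1"
    by (simp add: quat_eq_iff)
  have conj: "Quat (qre x) (- qi x) (- qj x) (- qk x) * x = (norm x)\<^sup>2 *\<^sub>R 1"
    "x * Quat (qre x) (- qi x) (- qj x) (- qk x) = (norm x)\<^sup>2 *\<^sub>R 1"
    unfolding nrm by (simp_all add: quat_eq_iff power2_eq_square algebra_simps)
  have scl: "(r *\<^sub>R u) * v = r *\<^sub>R (u * v)" "u * (r *\<^sub>R v) = r *\<^sub>R (u * v)" for r and u v :: quat
    by (simp_all add: quat_eq_iff algebra_simps)
  show "inverse x * x = 1" "x * inverse x = 1" if "x \<noteq> 0"
    using that by (simp_all add: inverse_quat_def scl conj)
  show "x div y = x * inverse y"
    by (rule divide_quat_def)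
  show "inverse (0::quat) = 0"
    by (simp add: inverse_quat_def quat_eq_iff)
  have "(norm (x * y))\<^sup>2 = (norm x * norm y)\<^sup>2"
    unfolding power_mult_distrib nrm quat_sel_mult by algebra
  then show "norm (x * y) = norm x * norm y"
    by simp
qed

end

definition quat_im :: "quat \<Rightarrow> quat" where
  "quat_im q = Quat 0 (qi q) (qj q) (qk q)"


section \<open>Slices and slice regular functions\<close>

definition imag_units :: "quat set" where
  "imag_units = {q. q\<^sup>2 = - 1}"

definition slice_pt :: "quat \<Rightarrow> complex \<Rightarrow> quat" where
  "slice_pt i z = of_real (Re z) + i * of_real (Im z)"

definition slice_ball :: "quat \<Rightarrow> quat set" where
  "slice_ball i = ball 0 1 \<inter> range (slice_pt i)"

text \<open>
  Functions on the unit ball are represented by total functions; membership in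
  \<open>slice_regular\<close> depends only on the values on the (open) ball.
\<close>

definition slice_regular :: "(quat \<Rightarrow> quat) \<Rightarrow> bool" where
  "slice_regular f \<longleftrightarrow>
     f differentiable_on ball 0 1 \<and>
     (\<forall>i\<in>imag_units. \<forall>x y :: real. slice_pt i (Complex x y) \<in> ball 0 1 \<longrightarrow>
        vector_derivative (\<lambda>t. f (slice_pt i (Complex t y))) (at x) +
        i * vector_derivative (\<lambda>t. f (slice_pt i (Complex x t))) (at y) = 0)"

definition real_deriv :: "(quat \<Rightarrow> quat) \<Rightarrow> quat \<Rightarrow> quat" where
  "real_deriv f q = vector_derivative (\<lambda>t::real. f (q + of_real t)) (at 0)"


section \<open>Besov spaces\<close>

text \<open>
  The slice ball is parametrized by the complex unit disk; the factor \<open>1 / pi\<close> normalizes the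
  area measure.
\<close>

definition besov_integral :: "real \<Rightarrow> (quat \<Rightarrow> quat) \<Rightarrow> quat \<Rightarrow> ennreal" where
  "besov_integral p f i =
     (\<integral>\<^sup>+ z \<in> ball 0 1. ennreal
        (norm ((1 - (norm (slice_pt i z))\<^sup>2) *\<^sub>R real_deriv f (slice_pt i z)) powr p
         * (1 / (1 - (norm (slice_pt i z))\<^sup>2)\<^sup>2) * (1 / pi)) \<partial>lborel)"

definition besov_sup :: "real \<Rightarrow> (quat \<Rightarrow> quat) \<Rightarrow> ennreal" where
  "besov_sup p f = (SUP i\<in>imag_units. besov_integral p f i)"

text \<open>
  Elements of the Besov space are normalized to vanish outside the ball, so that equality of
  total functions is equality on the ball.
\<close>

definition besov :: "real \<Rightarrow> (quat \<Rightarrow> quat) set" where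
  "besov p = {f. slice_regular f \<and> besov_sup p f < \<infinity> \<and> (\<forall>q. q \<notin> ball 0 1 \<longrightarrow> f q = 0)}"

definition besov_norm :: "real \<Rightarrow> (quat \<Rightarrow> quat) \<Rightarrow> real" where
  "besov_norm p f = norm (f 0) + enn2real (besov_sup p f) powr (1 / p)"

definition besov_bounded :: "real \<Rightarrow> (quat \<Rightarrow> quat) set \<Rightarrow> bool" where
  "besov_bounded p A \<longleftrightarrow> A \<subseteq> besov p \<and> (\<exists>M. \<forall>f\<in>A. besov_norm p f \<le> M)"

definition besov_topology :: "real \<Rightarrow> (quat \<Rightarrow> quat) topology" where
  "besov_topology p =
     Metric_space.mtopology (besov p) (\<lambda>f g. besov_norm p (\<lambda>q. f q - g q))"

text \<open>
  Compact operators on the Besov space: right linear (over the quaternions) self-maps that send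
  bounded sets to relatively compact sets.
\<close>

definition besov_compact_operator ::
    "real \<Rightarrow> ((quat \<Rightarrow> quat) \<Rightarrow> (quat \<Rightarrow> quat)) \<Rightarrow> bool" where
  "besov_compact_operator p T \<longleftrightarrow>
     T ` besov p \<subseteq> besov p \<and>
     (\<forall>f\<in>besov p. \<forall>g\<in>besov p. T (\<lambda>q. f q + g q) = (\<lambda>q. T f q + T g q)) \<and>
     (\<forall>f\<in>besov p. \<forall>a. T (\<lambda>q. f q * a) = (\<lambda>q. T f q * a)) \<and>
     (\<forall>A. besov_bounded p A \<longrightarrow>
        compactin (besov_topology p) (besov_topology p closure_of (T ` A)))"


section \<open>Composition operators\<close>

text \<open>
  For real \<open>q\<close> the imaginary unit \<open>J\<close> below is \<open>0\<close> instead of an arbitrary unit; this is harmless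
  because \<open>y = 0\<close> then, so that the terms containing \<open>J\<close> cancel.
\<close>

definition slice_comp :: "quat \<Rightarrow> (quat \<Rightarrow> quat) \<Rightarrow> (quat \<Rightarrow> quat) \<Rightarrow> (quat \<Rightarrow> quat)" where
  "slice_comp i \<Phi> f q =
     (if q \<in> ball 0 1 then
        let x = qre q; y = norm (quat_im q); J = quat_im q /\<^sub>R y;
            g = (\<lambda>z. f (\<Phi> (slice_pt i z)))
        in (1 / 2) *\<^sub>R ((1 - J * i) * g (Complex x y) + (1 + J * i) * g (Complex x (- y)))
      else 0)"

lemma norm_imag_unit: "i \<in> imag_units \<Longrightarrow> norm i = 1"
proof -
  assume "i \<in> imag_units"
  then have "norm (i\<^sup>2) = 1"
    by (simp add: imag_units_def)
  then show ?thesis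
    using power2_eq_iff_nonneg[of "norm i" 1] by (simp add: norm_power)
qed

lemma qre_imag_unit:
  assumes "i \<in> imag_units"
  shows "qre i = 0"
proof (rule ccontr)
  assume *: "qre i \<noteq> 0"
  have "i * i = - 1"
    using assms by (simp add: imag_units_def power2_eq_square)
  then have e: "qre i * qre i - qi i * qi i - qj i * qj i - qk i * qk i = - 1"
    "qi i = 0" "qj i = 0" "qk i = 0"
    using * by (auto simp: quat_eq_iff)
  then have "qre i * qre i = - 1"
    by simp
  then show False
    using zero_le_square[of "qre i"] by linarith
qed

lemma slice_comp_on_slice:
  assumes i: "i \<in> imag_units" and q: "q \<in> slice_ball i"
  shows "slice_comp i \<Phi> f q = f (\<Phi> q)"
proof -
  obtain z where z: "q = slice_pt i z" and b: "q \<in> ball 0 1"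
    using q by (auto simp: slice_ball_def)
  have ii: "i * i = - 1"
    using i by (simp add: imag_units_def power2_eq_square)
  have re: "qre q = Re z"
    using qre_imag_unit[OF i] by (simp add: z slice_pt_def of_real_def)
  have im: "quat_im q = Im z *\<^sub>R i"
    using qre_imag_unit[OF i]
    by (simp add: z slice_pt_def quat_im_def of_real_def quat_eq_iff)
  have y: "norm (quat_im q) = \<bar>Im z\<bar>"
    by (simp add: im norm_imag_unit[OF i])
  define G where "G w = f (\<Phi> (slice_pt i w))" for w
  have eq: "slice_comp i \<Phi> f q = (1 / 2) *\<^sub>R
      ((1 - (quat_im q /\<^sub>R norm (quat_im q)) * i) * G (Complex (Re z) \<bar>Im z\<bar>) +
       (1 + (quat_im q /\<^sub>R norm (quat_im q)) * i) * G (Complex (Re z) (- \<bar>Im z\<bar>)))"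
    using b by (simp only: slice_comp_def Let_def if_True re y G_def)
  have two: "(1 / 2) *\<^sub>R ((1 + 1) * w) = w" for w :: quat
    by (simp add: quat_eq_iff)
  have "slice_comp i \<Phi> f q = G z"
  proof (cases "Im z = 0")
    case True
    then have "quat_im q /\<^sub>R norm (quat_im q) = 0"
      "Complex (Re z) \<bar>Im z\<bar> = z" "Complex (Re z) (- \<bar>Im z\<bar>) = z"
      by (simp_all add: im complex_eq_iff)
    then show ?thesis
      unfolding eq using two[of "G z"]
      by (simp only: mult_zero_left diff_zero add_0_right mult_1_left distrib_right)
  next
    case False
    show ?thesis
    proof (cases "Im z > 0")
      case True
      then have "quat_im q /\<^sub>R norm (quat_im q) = i" "Complex (Re z) \<bar>Im z\<bar> = z"
        by (simp_all only: y) (simp_all add: im complex_eq_iff)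
      then show ?thesis
        unfolding eq using two[of "G z"] by (simp only: ii) simp
    next
      case 2: False
      then have "quat_im q /\<^sub>R norm (quat_im q) = - i" "Complex (Re z) (- \<bar>Im z\<bar>) = z"
        using False by (simp_all only: y) (simp_all add: im complex_eq_iff)
      then show ?thesis
        unfolding eq using two[of "G z"] by (simp only: ii mult_minus_left) simp
    qed
  qed
  then show ?thesis
    by (simp add: G_def z)
qed

end

(*
  Point evaluations are bounded on the Besov space: on a slice the derivative of f has two
  holomorphic coordinates, whose values are controlled by area integrals. Hence a bounded
  sequence is locally bounded on one slice, Montel's theorem gives a subsequence that converges
  there, the representation formula carries the convergence to the whole ball and shows that the
  limit is slice regular, and Fatou's lemma puts the limit into the Besov space.

  If the sequence condition holds and h is such a limit of (f_m), it applies to f_m - h, so that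
  C f_m tends to C h in norm; this is compactness. (That C maps the space into itself is the
  sequence condition for f, 0, 0, ....) Conversely, if C is compact and f_m tends to 0 locally
  uniformly, then every norm limit of a subsequence of C f_m is also its pointwise limit, i.e. 0.
*)
theory Submission
  imports Defs "HOL-Complex_Analysis.Complex_Analysis"
begin

section \<open>An area estimate for holomorphic functions\<close>

text \<open>The obstacle is that the Besov condition bounds an integral of a p-th power, while
  Montel's theorem asks for pointwise bounds. The inequality x <= t + t^(1-p) x^p replaces the p-th
  power by an L^1 bound, to which an area estimate for a single holomorphic function applies; if t^p
  bounds the integral, both terms contribute a multiple of t, so the resulting bound is homogeneous.
  Noncommutativity is handled by reading slice regularity as complex linearity of the derivative for
  left multiplication by i. Right multiplication by a constant commutes with this structure. With a
  unit j that anticommutes with i, a function on the slice therefore splits as F + G j, where F and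
  G are holomorphic and G is a coordinate of f * (-j). The supremum over all slices requires
  constants that do not depend on the slice. For this reason the estimates are stated for an
  arbitrary bound s^p or t^p of the integral, which one chooses once for all slices.\<close>

lemma lborel_complex_conv_prod:
  "(lborel :: complex measure) = distr (lborel \<Otimes>\<^sub>M lborel) borel (\<lambda>(x, y). Complex x y)"
proof (rule lborel_eqI)
  have [measurable]: "(\<lambda>(x, y). Complex x y) \<in> borel_measurable (lborel \<Otimes>\<^sub>M lborel)"
    unfolding lborel_prod by (auto intro!: borel_measurable_continuous_onI continuous_intros simp: case_prod_beta)
  fix l u :: complex
  assume le: "\<And>b. b \<in> Basis \<Longrightarrow> l \<bullet> b \<le> u \<bullet> b"
  have lu: "Re l \<le> Re u" "Im l \<le> Im u"
    using le[of 1] le[of \<i>] by (auto simp: Basis_complex_def)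
  have eq: "(\<lambda>(x, y). Complex x y) -` box l u \<inter> space (lborel \<Otimes>\<^sub>M lborel)
      = {Re l<..<Re u} \<times> {Im l<..<Im u}"
    by (auto simp: in_box_complex_iff space_pair_measure)
  show "emeasure (distr (lborel \<Otimes>\<^sub>M lborel) borel (\<lambda>(x, y). Complex x y)) (box l u)
      = ennreal (\<Prod>b\<in>Basis. (u - l) \<bullet> b)"
    using lu by (simp add: emeasure_distr eq lborel.emeasure_pair_measure_Times Basis_complex_def
        ennreal_mult)
qed simp

text \<open>Tonelli's theorem in both orders: the area estimate integrates over vertical sides of
  squares as well as horizontal ones.\<close>

lemma nn_integral_complex_iterated:
  fixes k :: "complex \<Rightarrow> ennreal"
  assumes [measurable]: "k \<in> borel_measurable borel"
  shows "(\<lambda>x. \<integral>\<^sup>+y. k (Complex x y) \<partial>lborel) \<in> borel_measurable borel"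
    and "(\<lambda>y. \<integral>\<^sup>+x. k (Complex x y) \<partial>lborel) \<in> borel_measurable borel"
    and "(\<integral>\<^sup>+x. \<integral>\<^sup>+y. k (Complex x y) \<partial>lborel \<partial>lborel) = (\<integral>\<^sup>+z. k z \<partial>lborel)"
    and "(\<integral>\<^sup>+y. \<integral>\<^sup>+x. k (Complex x y) \<partial>lborel \<partial>lborel) = (\<integral>\<^sup>+z. k z \<partial>lborel)"
proof -
  have [measurable]: "(\<lambda>(x, y). Complex x y) \<in> borel_measurable (lborel \<Otimes>\<^sub>M lborel)"
    unfolding lborel_prod by (auto intro!: borel_measurable_continuous_onI continuous_intros simp: case_prod_beta)
  have m: "(\<lambda>(x, y). k (Complex x y)) \<in> borel_measurable (lborel \<Otimes>\<^sub>M lborel)"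
    using measurable_compose[OF \<open>(\<lambda>(x, y). Complex x y) \<in> _\<close> assms] by (simp add: case_prod_beta)
  have m2: "(\<lambda>(y, x). k (Complex x y)) \<in> borel_measurable (lborel \<Otimes>\<^sub>M lborel)"
    using measurable_pair_swap[OF m] by (simp add: case_prod_beta)
  show "(\<lambda>x. \<integral>\<^sup>+y. k (Complex x y) \<partial>lborel) \<in> borel_measurable borel"
    using lborel.borel_measurable_nn_integral[OF m] by simp
  show "(\<lambda>y. \<integral>\<^sup>+x. k (Complex x y) \<partial>lborel) \<in> borel_measurable borel"
    using lborel.borel_measurable_nn_integral[OF m2] by simp
  have "(\<integral>\<^sup>+z. k z \<partial>lborel) = (\<integral>\<^sup>+w. k ((\<lambda>(x, y). Complex x y) w) \<partial>(lborel \<Otimes>\<^sub>M lborel))"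
    by (subst lborel_complex_conv_prod, subst nn_integral_distr) auto
  also have "\<dots> = (\<integral>\<^sup>+x. \<integral>\<^sup>+y. k (Complex x y) \<partial>lborel \<partial>lborel)"
    by (subst lborel.nn_integral_fst[symmetric]) (use m in \<open>auto simp: case_prod_beta\<close>)
  finally show *: "(\<integral>\<^sup>+x. \<integral>\<^sup>+y. k (Complex x y) \<partial>lborel \<partial>lborel) = (\<integral>\<^sup>+z. k z \<partial>lborel)" ..
  show "(\<integral>\<^sup>+y. \<integral>\<^sup>+x. k (Complex x y) \<partial>lborel \<partial>lborel) = (\<integral>\<^sup>+z. k z \<partial>lborel)"
    using lborel_pair.Fubini'[OF m] * by simp
qed

text \<open>Passing to \<open>ennreal\<close> and to an integral over the whole line lets the bound
  enter Tonelli's theorem without integrability conditions.\<close>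

lemma norm_contour_integral_linepath_le:
  assumes "continuous_on (closed_segment a b) f"
  shows "ennreal (norm (contour_integral (linepath a b) f))
    \<le> ennreal (norm (b - a)) * (\<integral>\<^sup>+t. ennreal (norm (f (linepath a b t))) * indicator {0..1} t \<partial>lborel)"
proof -
  have c: "continuous_on {0..1} (\<lambda>t. f (linepath a b t))"
    by (rule continuous_on_compose2[OF assms]) (auto simp: linepath_image_01[symmetric] intro!: continuous_intros)
  have cn: "continuous_on {0..1} (\<lambda>t. norm (f (linepath a b t)))"
    by (intro continuous_intros c)
  have i: "(\<lambda>t. norm (f (linepath a b t))) integrable_on {0..1}"
    by (intro integrable_continuous_interval cn)
  have "norm (contour_integral (linepath a b) f) = norm (integral {0..1} (\<lambda>t. f (linepath a b t) * (b - a)))"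
    by (simp add: contour_integral_integral)
  also have "\<dots> \<le> integral {0..1} (\<lambda>t. norm (f (linepath a b t)) * norm (b - a))"
    by (rule integral_norm_bound_integral)
       (auto intro!: integrable_continuous_interval continuous_intros c simp: norm_mult)
  also have "\<dots> = norm (b - a) * integral {0..1} (\<lambda>t. norm (f (linepath a b t)))"
    by (simp add: mult.commute)
  finally have le: "norm (contour_integral (linepath a b) f) \<le> norm (b - a) * integral {0..1} (\<lambda>t. norm (f (linepath a b t)))" .
  have "(\<integral>\<^sup>+t. ennreal (norm (f (linepath a b t))) * indicator {0..1} t \<partial>lborel) =
     (\<integral>\<^sup>+t. ennreal (norm (f (linepath a b t)) * indicator {0..1} t) \<partial>lborel)"
    by (intro nn_integral_cong) (auto split: split_indicator)
  also have "\<dots> = ennreal (integral {0..1} (\<lambda>t. norm (f (linepath a b t))))"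
  proof -
    have "(\<lambda>t. indicator {0..1} t *\<^sub>R norm (f (linepath a b t))) \<in> borel_measurable borel"
      by (rule borel_measurable_continuous_on_indicator[OF _ cn]) simp
    then have "(\<lambda>t. norm (f (linepath a b t)) * indicator {0..1} t) \<in> borel_measurable borel"
      by (simp add: mult.commute)
    moreover have "((\<lambda>t. norm (f (linepath a b t)) * indicator {0..1} t) has_integral integral {0..1} (\<lambda>t. norm (f (linepath a b t)))) UNIV"
      using integrable_integral[OF i]
      by (subst (asm) has_integral_restrict_UNIV[symmetric])
         (simp add: indicator_def of_bool_def if_distrib cong: if_cong)
    ultimately show ?thesis
      by (intro nn_integral_has_integral_lborel) (auto simp: integral_nonneg i)
  qed
  finally show ?thesis
    using le by (simp add: ennreal_mult'[symmetric] integral_nonneg i)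
qed

text \<open>Cauchy's formula on the concentric squares of half side \<open>s \<le> r\<close>, integrated over \<open>s\<close>. The
  constant \<open>4\<close> is not sharp: each of the four families of sides is bounded by the whole square.\<close>

lemma holomorphic_area_bound:
  assumes hol: "K holomorphic_on S" and S: "cbox (z - Complex r r) (z + Complex r r) \<subseteq> S" and r: "r > 0"
  shows "ennreal (pi * r\<^sup>2 * norm (K z))
    \<le> 4 * (\<integral>\<^sup>+w\<in>cbox (z - Complex r r) (z + Complex r r). ennreal (norm (K w)) \<partial>lborel)"
proof -
  define Q where "Q = cbox (z - Complex r r) (z + Complex r r)"
  have hQ: "K holomorphic_on Q" and cQ: "continuous_on Q K"
    using hol S holomorphic_on_subset holomorphic_on_imp_continuous_on unfolding Q_def by blast+
  \<comment> \<open>Extension by zero outside \<open>Q\<close> turns the integral over a side into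
    at most an integral over a full line, and full lines can be translated freely in the final
    integration over \<open>s\<close>.\<close>
  define k where "k w = ennreal (norm (K w)) * indicator Q w" for w
  have k: "k \<in> borel_measurable borel"
  proof -
    have "(\<lambda>w. indicator Q w *\<^sub>R norm (K w)) \<in> borel_measurable borel"
      by (rule borel_measurable_continuous_on_indicator) (auto simp: Q_def intro!: continuous_intros cQ[unfolded Q_def])
    then have "(\<lambda>w. ennreal (indicator Q w *\<^sub>R norm (K w))) \<in> borel_measurable borel"
      by simp
    moreover have "k = (\<lambda>w. ennreal (indicator Q w *\<^sub>R norm (K w)))"
      by (auto simp: k_def fun_eq_iff split: split_indicator)
    ultimately show ?thesis by simp
  qed
  define V where "V x = (\<integral>\<^sup>+y. k (Complex x y) \<partial>lborel)" for x
  define H where "H y = (\<integral>\<^sup>+x. k (Complex x y) \<partial>lborel)" for y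
  note it = nn_integral_complex_iterated[OF k, folded V_def H_def]
  note [measurable] = k it(1,2)
  have [measurable]: "(\<lambda>y. k (Complex x y)) \<in> borel_measurable borel" for x
    by (rule measurable_compose[OF _ k]) (auto intro!: borel_measurable_continuous_onI continuous_intros)
  have [measurable]: "(\<lambda>x. k (Complex x y)) \<in> borel_measurable borel" for y
    by (rule measurable_compose[OF _ k]) (auto intro!: borel_measurable_continuous_onI continuous_intros)
  \<comment> \<open>On a side of the square the kernel 1 / (w - z) is at most 1 / s, which the
    factor \<open>s\<close> cancels. Here \<open>c\<close> is the signed length of the side and
    \<open>g\<close> is \<open>k\<close> along the line containing it; the substitution u = d + c t
    absorbs the length.\<close>
  have side: "ennreal (s * norm (contour_integral (linepath a b) (\<lambda>w. K w / (w - z)))) \<le> (\<integral>\<^sup>+u. g u \<partial>lborel)"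
    if s: "0 < s" and g: "g \<in> borel_measurable borel" and ab: "closed_segment a b \<subseteq> Q"
      and sz: "\<And>w. w \<in> closed_segment a b \<Longrightarrow> s \<le> norm (w - z)"
      and c: "norm (b - a) = \<bar>c\<bar>" "c \<noteq> 0"
      and gk: "\<And>t. t \<in> {0..1} \<Longrightarrow> k (linepath a b t) = g (d + c * t)" for s a b g c d
  proof -
    have nz: "w \<noteq> z" if "w \<in> closed_segment a b" for w using sz[OF that] s by auto
    have "ennreal (norm (contour_integral (linepath a b) (\<lambda>w. K w / (w - z)))) \<le>
      ennreal \<bar>c\<bar> * (\<integral>\<^sup>+t. ennreal (norm (K (linepath a b t) / (linepath a b t - z))) * indicator {0..1} t \<partial>lborel)"
      unfolding c(1)[symmetric]
      by (rule norm_contour_integral_linepath_le)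
         (use nz ab in \<open>auto intro!: continuous_intros continuous_on_subset[OF cQ]\<close>)
    then have "ennreal s * ennreal (norm (contour_integral (linepath a b) (\<lambda>w. K w / (w - z)))) \<le>
      ennreal s * (ennreal \<bar>c\<bar> * (\<integral>\<^sup>+t. ennreal (norm (K (linepath a b t) / (linepath a b t - z))) * indicator {0..1} t \<partial>lborel))"
      by (rule mult_left_mono) simp
    also have "\<dots> = ennreal \<bar>c\<bar> * (ennreal s * (\<integral>\<^sup>+t. ennreal (norm (K (linepath a b t) / (linepath a b t - z))) * indicator {0..1} t \<partial>lborel))"
      by (rule mult.left_commute)
    also have "\<dots> \<le> ennreal \<bar>c\<bar> * (\<integral>\<^sup>+t. g (d + c * t) \<partial>lborel)"
    proof (rule mult_left_mono)
      show "ennreal s * (\<integral>\<^sup>+t. ennreal (norm (K (linepath a b t) / (linepath a b t - z))) * indicator {0..1} t \<partial>lborel)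
       \<le> (\<integral>\<^sup>+t. g (d + c * t) \<partial>lborel)"
      proof -
        have "(\<lambda>t. indicator {0..1} t *\<^sub>R norm (K (linepath a b t) / (linepath a b t - z))) \<in> borel_measurable borel"
          by (rule borel_measurable_continuous_on_indicator)
             (use nz ab in \<open>auto intro!: continuous_intros continuous_on_compose2[OF cQ] simp: linepath_in_path\<close>)
        then have "(\<lambda>t. ennreal (indicator {0..1} t *\<^sub>R norm (K (linepath a b t) / (linepath a b t - z)))) \<in> borel_measurable borel"
          by simp
        also have "(\<lambda>t. ennreal (indicator {0..1} t *\<^sub>R norm (K (linepath a b t) / (linepath a b t - z))))
           = (\<lambda>t. ennreal (norm (K (linepath a b t) / (linepath a b t - z))) * indicator {0..1} t)"
          by (auto simp: fun_eq_iff split: split_indicator)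
        finally have m: "(\<lambda>t. ennreal (norm (K (linepath a b t) / (linepath a b t - z))) * indicator {0..1} t) \<in> borel_measurable borel" .
        have "ennreal s * (ennreal (norm (K (linepath a b t) / (linepath a b t - z))) * indicator {0..1} t) \<le> g (d + c * t)" for t
        proof (cases "t \<in> {0..1}")
          case True
          then have L: "linepath a b t \<in> closed_segment a b" by (simp add: linepath_in_path)
          then have "linepath a b t \<in> Q" using ab by blast
          then have "g (d + c * t) = ennreal (norm (K (linepath a b t)))"
            using gk[OF True] by (simp add: k_def)
          moreover have "s * (norm (K (linepath a b t)) / norm (linepath a b t - z)) \<le> norm (K (linepath a b t))"
            using mult_left_mono[OF sz[OF L], of "norm (K (linepath a b t))"] s nz[OF L] by (simp add: field_simps)
          ultimately show ?thesis using True s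
            by (simp add: ennreal_mult'[symmetric] norm_divide)
        qed simp
        then show ?thesis
          by (subst nn_integral_cmult[symmetric]) (use m in \<open>auto intro!: nn_integral_mono\<close>)
      qed
    qed simp
    also have "ennreal \<bar>c\<bar> * (\<integral>\<^sup>+t. g (d + c * t) \<partial>lborel) = (\<integral>\<^sup>+u. g u \<partial>lborel)"
      by (rule nn_integral_real_affine[OF g c(2), symmetric])
    finally show ?thesis using s by (simp add: ennreal_mult' mult_left_mono)
  qed
  have cauchy: "ennreal (2 * pi * norm (K z) * s) \<le> V (Re z + s) + V (Re z - s) + (H (Im z + s) + H (Im z - s))"
    if s: "0 < s" "s \<le> r" for s
  proof -
    define a1 a2 a3 a4 where "a1 = Complex (Re z - s) (Im z - s)" "a2 = Complex (Re z + s) (Im z - s)"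
      "a3 = Complex (Re z + s) (Im z + s)" "a4 = Complex (Re z - s) (Im z + s)"
    note a = a1_a2_a3_a4_def
    define F where "F w = K w / (w - z)" for w
    have aQ: "a1 \<in> Q" "a2 \<in> Q" "a3 \<in> Q" "a4 \<in> Q"
      using s r by (auto simp: a Q_def in_cbox_complex_iff)
    have seg: "closed_segment a1 a2 \<subseteq> Q" "closed_segment a2 a3 \<subseteq> Q" "closed_segment a3 a4 \<subseteq> Q" "closed_segment a4 a1 \<subseteq> Q"
      using aQ unfolding Q_def by (simp_all add: closed_segment_subset)
    have far: "s \<le> norm (w - z)" if "\<bar>Re w - Re z\<bar> = s \<or> \<bar>Im w - Im z\<bar> = s" for w
      using that abs_Re_le_cmod[of "w - z"] abs_Im_le_cmod[of "w - z"] by auto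
    have sz: "s \<le> norm (w - z)"
      if "w \<in> closed_segment a1 a2 \<union> closed_segment a2 a3 \<union> closed_segment a3 a4 \<union> closed_segment a4 a1" for w
      using that s by (intro far) (auto simp: a closed_segment_same_Re closed_segment_same_Im)
    have Fi: "F contour_integrable_on linepath x y"
      if "closed_segment x y \<subseteq> Q" "\<And>w. w \<in> closed_segment x y \<Longrightarrow> s \<le> norm (w - z)" for x y
      unfolding F_def
      by (rule contour_integrable_continuous_linepath)
         (use that s in \<open>force intro!: continuous_intros continuous_on_subset[OF cQ]\<close>)
    note Fis = Fi[OF seg(1)] Fi[OF seg(2)] Fi[OF seg(3)] Fi[OF seg(4)]
    have rp: "rectpath a1 a3 = linepath a1 a2 +++ linepath a2 a3 +++ linepath a3 a4 +++ linepath a4 a1"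
      by (simp add: rectpath_def a Let_def)
    have zb: "z \<in> box a1 a3" using s by (auto simp: a in_box_complex_iff)
    have "((\<lambda>w. K w / (w - z)) has_contour_integral (2 * pi * \<i> * winding_number (rectpath a1 a3) z * K z)) (rectpath a1 a3)"
    proof (rule Cauchy_integral_formula_convex_simple[OF _ hQ])
      show "z \<in> interior Q" using r by (simp add: Q_def interior_cbox in_box_complex_iff)
      have "path_image (rectpath a1 a3) \<subseteq> Q"
        by (rule order_trans[OF path_image_rectpath_subset_cbox])
           (use s in \<open>auto simp: a Q_def in_cbox_complex_iff\<close>)
      moreover have "z \<notin> path_image (rectpath a1 a3)"
        using zb s by (subst path_image_rectpath_cbox_minus_box) (auto simp: a)
      ultimately show "path_image (rectpath a1 a3) \<subseteq> Q - {z}" by blast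
    qed (auto simp: Q_def)
    then have "contour_integral (rectpath a1 a3) F = 2 * pi * \<i> * K z"
      by (simp add: winding_number_rectpath[OF zb] contour_integral_unique F_def[abs_def])
    also have "contour_integral (rectpath a1 a3) F = contour_integral (linepath a1 a2) F +
       (contour_integral (linepath a2 a3) F + (contour_integral (linepath a3 a4) F + contour_integral (linepath a4 a1) F))"
      unfolding rp using Fis sz by simp
    finally have "2 * pi * norm (K z) = norm (contour_integral (linepath a1 a2) F +
       (contour_integral (linepath a2 a3) F + (contour_integral (linepath a3 a4) F + contour_integral (linepath a4 a1) F)))"
      by (simp add: norm_mult)
    also have "\<dots> \<le> norm (contour_integral (linepath a1 a2) F) + norm (contour_integral (linepath a2 a3) F)
       + (norm (contour_integral (linepath a3 a4) F) + norm (contour_integral (linepath a4 a1) F))"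
      using norm_triangle_ineq by (smt (verit) norm_triangle_ineq)
    finally have le1: "2 * pi * norm (K z) \<le> norm (contour_integral (linepath a1 a2) F) + norm (contour_integral (linepath a2 a3) F)
       + (norm (contour_integral (linepath a3 a4) F) + norm (contour_integral (linepath a4 a1) F))" .
    have "2 * pi * norm (K z) * s \<le> s * norm (contour_integral (linepath a2 a3) F) + s * norm (contour_integral (linepath a4 a1) F)
       + (s * norm (contour_integral (linepath a3 a4) F) + s * norm (contour_integral (linepath a1 a2) F))"
      using mult_left_mono[OF le1, of s] s by (simp add: algebra_simps)
    then have "ennreal (2 * pi * norm (K z) * s) \<le> ennreal (s * norm (contour_integral (linepath a2 a3) F)) + ennreal (s * norm (contour_integral (linepath a4 a1) F))
       + (ennreal (s * norm (contour_integral (linepath a3 a4) F)) + ennreal (s * norm (contour_integral (linepath a1 a2) F)))"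
      using s by (simp flip: ennreal_plus)
    also have "\<dots> \<le> V (Re z + s) + V (Re z - s) + (H (Im z + s) + H (Im z - s))"
    proof -
      have lp: "linepath a2 a3 t = Complex (Re z + s) ((Im z - s) + (2 * s) * t)"
        "linepath a4 a1 t = Complex (Re z - s) ((Im z + s) + (- 2 * s) * t)"
        "linepath a3 a4 t = Complex ((Re z + s) + (- 2 * s) * t) (Im z + s)"
        "linepath a1 a2 t = Complex ((Re z - s) + (2 * s) * t) (Im z - s)" for t
        by (simp_all add: linepath_def a complex_eq_iff algebra_simps)
      have nm: "norm (a3 - a2) = \<bar>2 * s\<bar>" "norm (a1 - a4) = \<bar>- 2 * s\<bar>" "norm (a4 - a3) = \<bar>- 2 * s\<bar>" "norm (a2 - a1) = \<bar>2 * s\<bar>"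
        using s by (simp_all add: a cmod_def real_sqrt_mult)
      show ?thesis
        unfolding V_def H_def F_def
        by (intro add_mono side[OF s(1) _ seg(2) _ nm(1)] side[OF s(1) _ seg(4) _ nm(2)] side[OF s(1) _ seg(3) _ nm(3)] side[OF s(1) _ seg(1) _ nm(4)])
          (use s in \<open>auto intro!: sz simp: lp\<close>)
    qed
    finally show ?thesis .
  qed
  have aff: "(\<integral>\<^sup>+s. g (t + s) \<partial>lborel) = (\<integral>\<^sup>+s. g s \<partial>lborel)" "(\<integral>\<^sup>+s. g (t - s) \<partial>lborel) = (\<integral>\<^sup>+s. g s \<partial>lborel)"
    if "g \<in> borel_measurable borel" for g :: "real \<Rightarrow> ennreal" and t :: real
    using nn_integral_real_affine[OF that, of 1 t] nn_integral_real_affine[OF that, of "-1" t] by simp_all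
  \<comment> \<open>Integrating 2 pi s over the half sides from 0 to r produces the factor pi
    r^2.\<close>
  have "(\<integral>\<^sup>+s. ennreal (2 * pi * norm (K z) * s) * indicator {0..r} s \<partial>lborel) = pi * norm (K z) * r\<^sup>2 - pi * norm (K z) * 0\<^sup>2"
    by (rule nn_integral_FTC_Icc) (use r in \<open>auto intro!: derivative_eq_intros\<close>)
  then have "ennreal (pi * r\<^sup>2 * norm (K z)) = (\<integral>\<^sup>+s. ennreal (2 * pi * norm (K z) * s) * indicator {0..r} s \<partial>lborel)"
    by (simp add: mult_ac)
  also have "\<dots> \<le> (\<integral>\<^sup>+s. V (Re z + s) + V (Re z - s) + (H (Im z + s) + H (Im z - s)) \<partial>lborel)"
  proof (rule nn_integral_mono)
    fix s :: real
    show "ennreal (2 * pi * norm (K z) * s) * indicator {0..r} s \<le> V (Re z + s) + V (Re z - s) + (H (Im z + s) + H (Im z - s))"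
      using cauchy[of s] by (cases "s = 0") (auto split: split_indicator)
  qed
  also have "\<dots> = 4 * (\<integral>\<^sup>+w. k w \<partial>lborel)"
  proof -
    have "(\<integral>\<^sup>+s. V (Re z + s) + V (Re z - s) + (H (Im z + s) + H (Im z - s)) \<partial>lborel) =
      (\<integral>\<^sup>+s. V (Re z + s) \<partial>lborel) + (\<integral>\<^sup>+s. V (Re z - s) \<partial>lborel) + ((\<integral>\<^sup>+s. H (Im z + s) \<partial>lborel) + (\<integral>\<^sup>+s. H (Im z - s) \<partial>lborel))"
      by (simp add: nn_integral_add)
    also have "\<dots> = (\<integral>\<^sup>+w. k w \<partial>lborel) + (\<integral>\<^sup>+w. k w \<partial>lborel) + ((\<integral>\<^sup>+w. k w \<partial>lborel) + (\<integral>\<^sup>+w. k w \<partial>lborel))"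
      by (simp only: aff it measurable_lborel1)
    also have "\<dots> = 4 * (\<integral>\<^sup>+w. k w \<partial>lborel)"
      using distrib_right[of "2::ennreal" 2 "\<integral>\<^sup>+w. k w \<partial>lborel"] by (simp add: mult_2)
    finally show ?thesis .
  qed
  finally show ?thesis by (simp add: k_def Q_def)
qed

section \<open>Quaternions as a complex vector space\<close>

lemma imag_units_iff:
  "i \<in> imag_units \<longleftrightarrow> qre i = 0 \<and> (qi i)\<^sup>2 + (qj i)\<^sup>2 + (qk i)\<^sup>2 = 1"
proof
  assume i: "i \<in> imag_units"
  then have "i * i = - 1" by (simp add: imag_units_def power2_eq_square)
  then show "qre i = 0 \<and> (qi i)\<^sup>2 + (qj i)\<^sup>2 + (qk i)\<^sup>2 = 1"
    using qre_imag_unit[OF i] by (simp add: quat_eq_iff power2_eq_square)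
next
  assume "qre i = 0 \<and> (qi i)\<^sup>2 + (qj i)\<^sup>2 + (qk i)\<^sup>2 = 1"
  then show "i \<in> imag_units"
    by (auto simp: imag_units_def quat_eq_iff power2_eq_square algebra_simps)
qed

lemma imag_unit_mult_self: "i \<in> imag_units \<Longrightarrow> i * i = - 1"
  by (simp add: imag_units_def power2_eq_square)

lemma imag_unit_mult_self_left: "i \<in> imag_units \<Longrightarrow> i * (i * q) = - q"
  using mult.assoc[of i i q] by (simp add: imag_unit_mult_self)

lemma imag_units_nonempty: "Quat 0 1 0 0 \<in> imag_units"
  by (simp add: imag_units_iff)

lemma slice_pt_alt: "slice_pt i z = of_real (Re z) + Im z *\<^sub>R i"
  by (simp add: slice_pt_def quat_eq_iff of_real_def)

lemma bounded_linear_slice_pt: "bounded_linear (slice_pt i)"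
  unfolding slice_pt_alt[abs_def]
  by (intro bounded_linear_add bounded_linear_compose[OF bounded_linear_of_real bounded_linear_Re]
      bounded_linear_compose[OF bounded_linear_scaleR_left bounded_linear_Im])

lemmas slice_pt_linear_simps =
  linear_0[OF bounded_linear.linear[OF bounded_linear_slice_pt]]
  linear_add[OF bounded_linear.linear[OF bounded_linear_slice_pt]]
  linear_diff[OF bounded_linear.linear[OF bounded_linear_slice_pt]]
  linear_neg[OF bounded_linear.linear[OF bounded_linear_slice_pt]]
  linear_scale[OF bounded_linear.linear[OF bounded_linear_slice_pt]]

lemmas slice_pt_tendsto [tendsto_intros] = bounded_linear.tendsto[OF bounded_linear_slice_pt]
lemmas slice_pt_continuous_on [continuous_intros] = bounded_linear.continuous_on[OF bounded_linear_slice_pt]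

lemma slice_pt_of_real [simp]: "slice_pt i (of_real x) = of_real x"
  by (simp add: slice_pt_def)

lemma slice_pt_mult:
  assumes "i \<in> imag_units"
  shows "slice_pt i (z * w) = slice_pt i z * slice_pt i w"
proof -
  have "slice_pt i z * slice_pt i w = (Re z * Re w) *\<^sub>R 1 + (Re z * Im w) *\<^sub>R i + (Im z * Re w) *\<^sub>R i + (Im z * Im w) *\<^sub>R (i * i)"
    by (simp add: slice_pt_alt of_real_def distrib_left distrib_right scaleR_add_right)
       (simp add: mult.commute)
  then show ?thesis
    unfolding imag_unit_mult_self[OF assms]
    by (simp add: slice_pt_alt of_real_def scaleR_diff_left scaleR_add_left)
qed

lemma norm_quat: "norm q = sqrt ((qre q)\<^sup>2 + (qi q)\<^sup>2 + (qj q)\<^sup>2 + (qk q)\<^sup>2)"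
  by (simp add: norm_quat_def inner_quat_def power2_eq_square)

lemma norm_slice_pt:
  assumes "i \<in> imag_units"
  shows "norm (slice_pt i z) = norm z"
proof -
  have "(qi i)\<^sup>2 + (qj i)\<^sup>2 + (qk i)\<^sup>2 = 1" "qre i = 0"
    using assms by (auto simp: imag_units_iff)
  then have "(Re z)\<^sup>2 + (Im z * qi i)\<^sup>2 + (Im z * qj i)\<^sup>2 + (Im z * qk i)\<^sup>2 = (Re z)\<^sup>2 + (Im z)\<^sup>2"
    by (simp add: power_mult_distrib flip: distrib_left add.assoc)
  then show ?thesis
    using \<open>qre i = 0\<close> by (simp add: norm_quat cmod_def slice_pt_alt of_real_def)
qed

text \<open>A real \<open>q\<close> lies on every slice, so an arbitrary unit is chosen for it,
  while its normalized imaginary part is 0.\<close>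

lemma quat_on_slice:
  obtains i where "i \<in> imag_units" "q = slice_pt i (Complex (qre q) (norm (quat_im q)))"
    "quat_im q /\<^sub>R norm (quat_im q) = (if quat_im q = 0 then 0 else i)"
proof (cases "quat_im q = 0")
  case True
  then have "q = of_real (qre q)"
    by (simp add: quat_im_def quat_eq_iff of_real_def)
  then show ?thesis
    using that[OF imag_units_nonempty] True by (simp add: slice_pt_def)
next
  case False
  define n where "n = norm (quat_im q)"
  have n: "n \<noteq> 0" "n\<^sup>2 = (qi q)\<^sup>2 + (qj q)\<^sup>2 + (qk q)\<^sup>2"
    using False by (simp_all add: n_def) (simp add: norm_quat quat_im_def)
  have "(inverse n)\<^sup>2 * ((qi q)\<^sup>2 + (qj q)\<^sup>2 + (qk q)\<^sup>2) = 1"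
    using n(1) by (simp add: power_inverse flip: n(2))
  then have "quat_im q /\<^sub>R n \<in> imag_units"
    by (simp add: imag_units_iff quat_im_def power_mult_distrib distrib_left)
  moreover have "q = slice_pt (quat_im q /\<^sub>R n) (Complex (qre q) n)"
    using n by (simp add: slice_pt_alt quat_im_def quat_eq_iff of_real_def)
  ultimately show ?thesis
    using False unfolding n_def by (intro that) auto
qed

lemma quat_im_slice_pt: "i \<in> imag_units \<Longrightarrow> quat_im (slice_pt i z) = Im z *\<^sub>R i"
  by (simp add: imag_units_iff slice_pt_alt quat_im_def quat_eq_iff of_real_def)

lemma qre_slice_pt: "i \<in> imag_units \<Longrightarrow> qre (slice_pt i z) = Re z"
  by (simp add: imag_units_iff slice_pt_alt of_real_def)

section \<open>Complex coordinates of a quaternion\<close>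

text \<open>For a unit \<open>i\<close> this is the orthogonal projection onto the plane C(i), read
  as a complex number.\<close>

definition slice_coord :: "quat \<Rightarrow> quat \<Rightarrow> complex" where
  "slice_coord i q = Complex (qre q) (inner q i)"

lemma bounded_linear_slice_coord: "bounded_linear (slice_coord i)"
proof -
  have "bounded_linear (\<lambda>q. of_real (inner q 1) + of_real (inner q i) * \<i>)"
    by (intro bounded_linear_add bounded_linear_compose[OF bounded_linear_of_real bounded_linear_inner_left]
      bounded_linear_compose[OF bounded_linear_mult_left bounded_linear_compose[OF bounded_linear_of_real bounded_linear_inner_left]])
  moreover have "slice_coord i = (\<lambda>q. of_real (inner q 1) + of_real (inner q i) * \<i>)"
    by (auto simp: slice_coord_def fun_eq_iff complex_eq_iff inner_quat_def)
  ultimately show ?thesis by simp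
qed

lemmas slice_coord_linear_simps =
  linear_0[OF bounded_linear.linear[OF bounded_linear_slice_coord]]
  linear_add[OF bounded_linear.linear[OF bounded_linear_slice_coord]]
  linear_diff[OF bounded_linear.linear[OF bounded_linear_slice_coord]]

text \<open>The complex structure on the quaternions used here is left multiplication by \<open>i\<close>.\<close>

lemma slice_coord_mult:
  assumes "i \<in> imag_units"
  shows "slice_coord i (slice_pt i z * q) = z * slice_coord i q"
proof -
  have i: "qre i = 0" "(qi i)\<^sup>2 + (qj i)\<^sup>2 + (qk i)\<^sup>2 = 1"
    using assms by (auto simp: imag_units_iff)
  have "inner (i * q) i = qre q"
  proof -
    have "inner (i * q) i = qre q * ((qi i)\<^sup>2 + (qj i)\<^sup>2 + (qk i)\<^sup>2)"
      unfolding inner_quat_def by (simp add: i(1) power2_eq_square algebra_simps)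
    then show ?thesis by (simp add: i)
  qed
  moreover have "qre (i * q) = - inner q i"
    by (simp add: inner_quat_def i(1))
  moreover have "slice_pt i z * q = Re z *\<^sub>R q + Im z *\<^sub>R (i * q)"
    by (simp add: slice_pt_alt of_real_def distrib_right)
  ultimately show ?thesis
    by (simp only: slice_coord_def inner_add_left inner_scaleR_left complex_eq_iff) simp
qed

text \<open>The map q -> - i q i is the identity on C(i), whose elements commute with i, and minus
  the identity on the orthogonal complement, whose elements anticommute with i. Its average with the
  identity is therefore the projection onto C(i).\<close>

lemma slice_pt_slice_coord:
  assumes "i \<in> imag_units"
  shows "slice_pt i (slice_coord i q) = (1/2) *\<^sub>R (q - i * q * i)"
proof -
  have i: "qre i = 0" "(qi i)\<^sup>2 + (qj i)\<^sup>2 + (qk i)\<^sup>2 = 1"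
    using assms by (auto simp: imag_units_iff)
  have "i * q * i = ((qi i)\<^sup>2 + (qj i)\<^sup>2 + (qk i)\<^sup>2) *\<^sub>R (quat_im q - of_real (qre q)) - (2 * inner q i) *\<^sub>R i"
    by (simp add: quat_eq_iff inner_quat_def i(1) of_real_def quat_im_def power2_eq_square algebra_simps)
  then have "i * q * i = quat_im q - of_real (qre q) - (2 * inner q i) *\<^sub>R i"
    by (simp add: i)
  moreover have "q = of_real (qre q) + quat_im q"
    by (simp add: quat_eq_iff of_real_def quat_im_def)
  ultimately have "q - i * q * i = (of_real (qre q) + quat_im q) - (quat_im q - of_real (qre q) - (2 * inner q i) *\<^sub>R i)"
    by argo
  then have "q - i * q * i = 2 *\<^sub>R of_real (qre q) + (2 * inner q i) *\<^sub>R i"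
    by (simp add: scaleR_2)
  then show ?thesis
    by (simp add: slice_pt_alt slice_coord_def scaleR_add_right)
qed

lemma norm_slice_coord_le:
  assumes "i \<in> imag_units"
  shows "norm (slice_coord i q) \<le> norm q"
proof -
  have "norm (slice_coord i q) = norm ((1/2) *\<^sub>R (q - i * q * i))"
    using norm_slice_pt[OF assms, of "slice_coord i q"] by (simp only: slice_pt_slice_coord[OF assms])
  also have "\<dots> \<le> (1/2) * (norm q + norm (i * q * i))"
    using norm_triangle_ineq4[of q "i * q * i"] by simp
  also have "\<dots> = norm q" by (simp add: norm_mult norm_imag_unit[OF assms])
  finally show ?thesis .
qed

text \<open>Two imaginary units anticommute exactly if they are orthogonal. The witness is the part
  of \<open>i\<close> in the last two coordinates, turned by a right angle and normalized; if that
  part vanishes, the third basis vector is orthogonal to \<open>i\<close>.\<close>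

lemma orthogonal_imag_unit:
  assumes "i \<in> imag_units"
  obtains j where "j \<in> imag_units" "j * i = - (i * j)"
proof -
  have i: "qre i = 0" "(qi i)\<^sup>2 + (qj i)\<^sup>2 + (qk i)\<^sup>2 = 1"
    using assms by (auto simp: imag_units_iff)
  show ?thesis
  proof (cases "qj i = 0 \<and> qk i = 0")
    case True
    then show ?thesis
      using that[of "Quat 0 0 1 0"] i by (simp add: imag_units_iff quat_eq_iff)
  next
    case False
    define n where "n = sqrt ((qj i)\<^sup>2 + (qk i)\<^sup>2)"
    have n: "n \<noteq> 0" "n\<^sup>2 = (qj i)\<^sup>2 + (qk i)\<^sup>2"
      using False by (auto simp: n_def sum_power2_eq_zero_iff)
    have "Quat 0 0 (- qk i / n) (qj i / n) \<in> imag_units"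
      using n(1) unfolding imag_units_iff
      by (simp add: power_divide add.commute flip: add_divide_distrib n(2))
    moreover have "Quat 0 0 (- qk i / n) (qj i / n) * i = - (i * Quat 0 0 (- qk i / n) (qj i / n))"
      using i(1) n(1) by (simp add: quat_eq_iff field_simps)
    ultimately show ?thesis by (rule that)
  qed
qed

text \<open>This is the splitting of the quaternions into C(i) and C(i) j. Right multiplication by
  -j is the inverse of right multiplication by j, so it carries the second summand back to C(i),
  where the projection reads it off.\<close>

lemma slice_decomposition:
  assumes i: "i \<in> imag_units" and j: "j \<in> imag_units" "j * i = - (i * j)"
  shows "q = slice_pt i (slice_coord i q) + slice_pt i (slice_coord i (q * (- j))) * j"
proof -
  have "i * (q * (- j)) * i * j = i * q * i * j * j"
    using j(2) by (simp add: mult.assoc)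
  also have "\<dots> = - (i * q * i)"
    using imag_unit_mult_self[OF j(1)] by (simp add: mult.assoc)
  finally have "(q * (- j) - i * (q * (- j)) * i) * j = q + i * q * i"
    using imag_unit_mult_self[OF j(1)] by (simp add: algebra_simps mult.assoc)
  then have "slice_pt i (slice_coord i q) + slice_pt i (slice_coord i (q * (- j))) * j
      = (1/2) *\<^sub>R ((q - i * q * i) + (q + i * q * i))"
    unfolding slice_pt_slice_coord[OF i] mult_scaleR_left by (simp only: scaleR_add_right)
  also have "\<dots> = q" by (simp flip: scaleR_2)
  finally show ?thesis ..
qed

lemma norm_le_slice_coords:
  assumes i: "i \<in> imag_units" and j: "j \<in> imag_units" "j * i = - (i * j)"
  shows "norm q \<le> norm (slice_coord i q) + norm (slice_coord i (q * (- j)))"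
proof -
  have "norm q = norm (slice_pt i (slice_coord i q) + slice_pt i (slice_coord i (q * (- j))) * j)"
    using slice_decomposition[OF assms, of q] by simp
  also have "\<dots> \<le> norm (slice_pt i (slice_coord i q)) + norm (slice_pt i (slice_coord i (q * (- j))) * j)"
    by (rule norm_triangle_ineq)
  finally show ?thesis
    by (simp add: norm_mult norm_slice_pt[OF i] norm_imag_unit[OF j(1)])
qed

section \<open>Slice regular functions\<close>

lemma has_vector_derivative_along_line:
  assumes "(f has_derivative D) (at (a + t *\<^sub>R v))"
  shows "((\<lambda>t. f (a + t *\<^sub>R v)) has_vector_derivative D v) (at t)"
proof -
  have "((\<lambda>t. a + t *\<^sub>R v) has_derivative (\<lambda>s. s *\<^sub>R v)) (at t)"
    by (auto intro!: derivative_eq_intros)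
  from has_derivative_compose[OF this assms]
  have "((\<lambda>t. f (a + t *\<^sub>R v)) has_derivative (\<lambda>s. D (s *\<^sub>R v))) (at t)" .
  then show ?thesis
    unfolding has_vector_derivative_def
    by (simp add: linear_scale[OF has_derivative_linear[OF assms]])
qed

lemma slice_regular_imp_differentiable:
  "slice_regular f \<Longrightarrow> q \<in> ball 0 1 \<Longrightarrow> f differentiable at q"
  by (auto simp: slice_regular_def differentiable_on_def at_within_open[OF _ open_ball])

lemma real_deriv_eq:
  assumes "(f has_derivative D) (at q)"
  shows "real_deriv f q = D 1"
  using has_vector_derivative_along_line[of f D q 0 1] assms
  by (simp add: real_deriv_def of_real_def vector_derivative_at)

text \<open>Multiplying the slice equation D 1 + i D i = 0 by i gives D i = i D 1. A real linear map
  with this property is complex linear on the slice and is determined by D 1, the derivative in the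
  real direction.\<close>

lemma slice_regular_has_slice_derivative:
  assumes f: "slice_regular f" and i: "i \<in> imag_units" and z: "z \<in> ball 0 1"
  shows "((\<lambda>z. f (slice_pt i z)) has_derivative (\<lambda>w. slice_pt i w * real_deriv f (slice_pt i z))) (at z)"
proof -
  define q where "q = slice_pt i z"
  have q: "q \<in> ball 0 1" using z i by (simp add: q_def norm_slice_pt)
  then obtain D where D: "(f has_derivative D) (at q)"
    using slice_regular_imp_differentiable[OF f] by (auto simp: differentiable_def)
  have lin: "linear D" using D by (rule has_derivative_linear)
  have "((\<lambda>t. f (slice_pt i (Complex t (Im z)))) has_vector_derivative D 1) (at (Re z))"
    using has_vector_derivative_along_line[of f D "Im z *\<^sub>R i" "Re z" 1] D
    by (simp add: q_def slice_pt_alt of_real_def add.commute)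
  moreover have "((\<lambda>t. f (slice_pt i (Complex (Re z) t))) has_vector_derivative D i) (at (Im z))"
    using has_vector_derivative_along_line[of f D "of_real (Re z)" "Im z" i] D
    by (simp add: q_def slice_pt_alt)
  moreover have "slice_pt i (Complex (Re z) (Im z)) \<in> ball 0 1" using q by (simp add: q_def)
  moreover have "vector_derivative (\<lambda>t. f (slice_pt i (Complex t (Im z)))) (at (Re z)) +
      i * vector_derivative (\<lambda>t. f (slice_pt i (Complex (Re z) t))) (at (Im z)) = 0"
    if "slice_pt i (Complex (Re z) (Im z)) \<in> ball 0 1"
    using f i that unfolding slice_regular_def by blast
  ultimately have "D 1 + i * D i = 0"
    by (simp add: vector_derivative_at)
  then have "i * D 1 + i * (i * D i) = 0"
    by (metis distrib_left mult_zero_right)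
  then have Di: "D i = i * D 1"
    by (simp add: imag_unit_mult_self_left[OF i])
  have "D (slice_pt i w) = slice_pt i w * D 1" for w
    by (simp add: slice_pt_alt of_real_def linear_add[OF lin] linear_scale[OF lin] Di distrib_right)
  moreover have "((\<lambda>z. f (slice_pt i z)) has_derivative (\<lambda>w. D (slice_pt i w))) (at z)"
    by (rule has_derivative_compose[OF bounded_linear_imp_has_derivative[OF bounded_linear_slice_pt] D[unfolded q_def]])
  ultimately show ?thesis
    using real_deriv_eq[OF D] by (simp add: q_def)
qed

text \<open>Evaluating the slice derivative at 1 and at the imaginary unit recovers the
  Cauchy-Riemann equation. Differentiability in four real variables is a separate condition, since
  slicewise information alone does not give it.\<close>

lemma slice_regularI:
  assumes "f differentiable_on ball 0 1"
    and d: "\<And>i z. i \<in> imag_units \<Longrightarrow> z \<in> ball 0 1 \<Longrightarrow>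
      \<exists>c. ((\<lambda>z. f (slice_pt i z)) has_derivative (\<lambda>w. slice_pt i w * c)) (at z)"
  shows "slice_regular f"
  unfolding slice_regular_def
proof (intro conjI ballI allI impI)
  fix i x y assume i: "i \<in> imag_units" and b: "slice_pt i (Complex x y) \<in> ball 0 1"
  then have "Complex x y \<in> ball 0 1" by (simp add: norm_slice_pt)
  then obtain c where c: "((\<lambda>z. f (slice_pt i z)) has_derivative (\<lambda>w. slice_pt i w * c)) (at (Complex x y))"
    using d[OF i] by blast
  have "((\<lambda>t. f (slice_pt i (Complex t y))) has_vector_derivative c) (at x)"
    using has_vector_derivative_along_line[of "\<lambda>z. f (slice_pt i z)" "\<lambda>w. slice_pt i w * c" "Complex 0 y" x 1] c
    by (simp add: scaleR_complex.code plus_complex.code one_complex.code slice_pt_def)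
  moreover have "((\<lambda>t. f (slice_pt i (Complex x t))) has_vector_derivative i * c) (at y)"
    using has_vector_derivative_along_line[of "\<lambda>z. f (slice_pt i z)" "\<lambda>w. slice_pt i w * c" "Complex x 0" y \<i>] c
    by (simp add: scaleR_complex.code plus_complex.code imaginary_unit.code slice_pt_def)
  ultimately show "vector_derivative (\<lambda>t. f (slice_pt i (Complex t y))) (at x) +
        i * vector_derivative (\<lambda>t. f (slice_pt i (Complex x t))) (at y) = 0"
    by (simp add: vector_derivative_at imag_unit_mult_self_left[OF i])
qed fact

text \<open>The factor \<open>a\<close> serves both coordinates at once, with \<open>a = 1\<close>
  and \<open>a = - j\<close>. Standing on the right, it does not disturb the complex structure on
  the left.\<close>

lemma has_field_derivative_slice_coord:
  assumes i: "i \<in> imag_units"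
    and g: "(g has_derivative (\<lambda>w. slice_pt i w * c)) (at z)"
  shows "((\<lambda>z. slice_coord i (g z * a)) has_field_derivative slice_coord i (c * a)) (at z)"
proof -
  have "((\<lambda>z. slice_coord i (g z * a)) has_derivative (\<lambda>w. slice_coord i (slice_pt i w * c * a))) (at z)"
    by (rule bounded_linear.has_derivative[OF bounded_linear_slice_coord])
       (rule bounded_linear.has_derivative[OF bounded_linear_mult_left g])
  then show ?thesis
    by (simp add: has_field_derivative_def mult.assoc slice_coord_mult[OF i] mult.commute[of "slice_coord i (c * a)"])
       (simp add: mult_commute_abs)
qed

lemma slice_regular_coord_derivative:
  assumes "slice_regular f" "i \<in> imag_units" "z \<in> ball 0 1"
  shows "((\<lambda>z. slice_coord i (f (slice_pt i z) * a)) has_field_derivative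
     slice_coord i (real_deriv f (slice_pt i z) * a)) (at z)"
  using has_field_derivative_slice_coord slice_regular_has_slice_derivative assms by blast

lemma slice_regular_coord_holomorphic:
  assumes f: "slice_regular f" and i: "i \<in> imag_units"
  shows "(\<lambda>z. slice_coord i (f (slice_pt i z) * a)) holomorphic_on ball 0 1"
  unfolding holomorphic_on_open[OF open_ball] using slice_regular_coord_derivative[OF f i] by blast

lemma real_deriv_coord_holomorphic:
  assumes f: "slice_regular f" and i: "i \<in> imag_units"
  shows "(\<lambda>z. slice_coord i (real_deriv f (slice_pt i z) * a)) holomorphic_on ball 0 1"
proof (rule holomorphic_transform)
  show "deriv (\<lambda>z. slice_coord i (f (slice_pt i z) * a)) holomorphic_on ball 0 1"
    by (intro holomorphic_deriv slice_regular_coord_holomorphic f i) auto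
qed (auto intro!: DERIV_imp_deriv slice_regular_coord_derivative f i)

text \<open>Differentiability as such says nothing about continuity of the derivative; it comes from
  holomorphy of the two coordinates. It is what makes the Besov integrand measurable.\<close>

lemma real_deriv_slice_continuous_on:
  assumes f: "slice_regular f" and i: "i \<in> imag_units"
  shows "continuous_on (ball 0 1) (\<lambda>z. real_deriv f (slice_pt i z))"
proof -
  obtain j where j: "j \<in> imag_units" "j * i = - (i * j)"
    using orthogonal_imag_unit[OF i] .
  let ?h = "\<lambda>z. real_deriv f (slice_pt i z)"
  have "continuous_on (ball 0 1) (\<lambda>z. slice_coord i (?h z * 1))"
     "continuous_on (ball 0 1) (\<lambda>z. slice_coord i (?h z * (- j)))"
    by (intro holomorphic_on_imp_continuous_on real_deriv_coord_holomorphic f i)+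
  then have "continuous_on (ball 0 1) (\<lambda>z. slice_pt i (slice_coord i (?h z * 1)) + slice_pt i (slice_coord i (?h z * (- j))) * j)"
    by (intro continuous_intros)
  then show ?thesis
    by (subst (asm) mult_1_right) (simp only: slice_decomposition[OF i j, symmetric])
qed

section \<open>Sums, negatives and zero\<close>

lemma slice_regular_add:
  assumes f: "slice_regular f" and g: "slice_regular g"
  shows "slice_regular (\<lambda>q. f q + g q)"
proof (rule slice_regularI)
  show "(\<lambda>q. f q + g q) differentiable_on ball 0 1"
    using f g by (intro differentiable_on_add) (auto simp: slice_regular_def)
  fix i z assume "i \<in> imag_units" "z \<in> ball (0::complex) 1"
  from has_derivative_add[OF slice_regular_has_slice_derivative[OF f this] slice_regular_has_slice_derivative[OF g this]]
  show "\<exists>c. ((\<lambda>z. f (slice_pt i z) + g (slice_pt i z)) has_derivative (\<lambda>w. slice_pt i w * c)) (at z)"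
    by (auto simp flip: distrib_left)
qed

lemma slice_regular_uminus:
  assumes f: "slice_regular f"
  shows "slice_regular (\<lambda>q. - f q)"
proof (rule slice_regularI)
  show "(\<lambda>q. - f q) differentiable_on ball 0 1"
    using f by (intro differentiable_on_minus) (auto simp: slice_regular_def)
  fix i z assume "i \<in> imag_units" "z \<in> ball (0::complex) 1"
  from has_derivative_minus[OF slice_regular_has_slice_derivative[OF f this]]
  show "\<exists>c. ((\<lambda>z. - f (slice_pt i z)) has_derivative (\<lambda>w. slice_pt i w * c)) (at z)"
    by (auto simp flip: mult_minus_right)
qed

lemma real_deriv_add:
  assumes f: "slice_regular f" and g: "slice_regular g" and q: "q \<in> ball 0 1"
  shows "real_deriv (\<lambda>q. f q + g q) q = real_deriv f q + real_deriv g q"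
proof -
  obtain D E where D: "(f has_derivative D) (at q)" "(g has_derivative E) (at q)"
    using slice_regular_imp_differentiable[OF f q] slice_regular_imp_differentiable[OF g q]
    by (auto simp: differentiable_def)
  show ?thesis
    by (simp add: real_deriv_eq[OF D(1)] real_deriv_eq[OF D(2)] real_deriv_eq[OF has_derivative_add[OF D]])
qed

text \<open>No differentiability is needed: \<open>vector_derivative\<close> is a choice operator, which returns the
  same junk value for \<open>f\<close> and \<open>- f\<close> if there is no derivative.\<close>

lemma norm_real_deriv_uminus: "norm (real_deriv (\<lambda>q. - f q) q) = norm (real_deriv f q)"
proof -
  define g where "g t = f (q + of_real t)" for t :: real
  have iff: "((\<lambda>t. - g t) has_vector_derivative D) (at 0) \<longleftrightarrow> (g has_vector_derivative - D) (at 0)" for D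
    using has_vector_derivative_minus[of g "- D" "at 0"] has_vector_derivative_minus[of "\<lambda>t. - g t" D "at 0"]
    by auto
  have "norm (vector_derivative (\<lambda>t. - g t) (at 0)) = norm (vector_derivative g (at 0))"
  proof (cases "\<exists>D. (g has_vector_derivative D) (at 0)")
    case True
    then obtain D where "(g has_vector_derivative D) (at 0)" ..
    then show ?thesis
      using iff[of "- D"] by (simp add: vector_derivative_at)
  next
    case False
    then have "\<not> ((\<lambda>t. - g t) has_vector_derivative D) (at 0)" "\<not> (g has_vector_derivative D) (at 0)" for D
      using iff by auto
    then show ?thesis by (simp add: vector_derivative_def)
  qed
  then show ?thesis by (simp only: real_deriv_def g_def[abs_def])
qed

lemma slice_regular_zero: "slice_regular (\<lambda>q. 0)"
  by (rule slice_regularI) (auto intro!: exI[of _ 0])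

lemma real_deriv_zero: "real_deriv (\<lambda>q. 0) q = 0"
  by (rule real_deriv_eq) (rule has_derivative_const)

section \<open>The Besov norm\<close>

text \<open>The weight is written with \<open>norm z\<close>, which for a unit \<open>i\<close>
  equals \<open>norm (slice_pt i z)\<close>, so that it visibly does not depend on the
  slice.\<close>

definition besov_density :: "real \<Rightarrow> (quat \<Rightarrow> quat) \<Rightarrow> quat \<Rightarrow> complex \<Rightarrow> real" where
  "besov_density p f i z =
     norm ((1 - (norm z)\<^sup>2) *\<^sub>R real_deriv f (slice_pt i z)) powr p * (1 / (1 - (norm z)\<^sup>2)\<^sup>2) * (1 / pi)"

lemma besov_density_nonneg: "0 \<le> besov_density p f i z"
  by (simp add: besov_density_def)

lemma besov_integral_eq:
  assumes "i \<in> imag_units"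
  shows "besov_integral p f i = (\<integral>\<^sup>+z\<in>ball 0 1. ennreal (besov_density p f i z) \<partial>lborel)"
  unfolding besov_integral_def besov_density_def by (simp add: norm_slice_pt[OF assms])

lemma besov_density_measurable:
  assumes f: "slice_regular f" and i: "i \<in> imag_units" and p: "p > 0"
  shows "(\<lambda>z. ennreal (besov_density p f i z) * indicator (ball 0 1) z) \<in> borel_measurable borel"
proof -
  have "continuous_on (ball 0 1) (besov_density p f i)"
    unfolding besov_density_def
    by (intro continuous_on_mult continuous_on_powr' continuous_on_divide continuous_on_norm continuous_on_scaleR
          continuous_on_diff continuous_on_power continuous_on_const continuous_on_id real_deriv_slice_continuous_on f i)
       (use p in \<open>auto simp: abs_square_eq_1\<close>)
  then have "(\<lambda>z. indicator (ball 0 1) z *\<^sub>R besov_density p f i z) \<in> borel_measurable borel"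
    by (intro borel_measurable_continuous_on_indicator) auto
  then have "(\<lambda>z. ennreal (indicator (ball 0 1) z *\<^sub>R besov_density p f i z)) \<in> borel_measurable borel"
    by simp
  also have "(\<lambda>z. ennreal (indicator (ball 0 1) z *\<^sub>R besov_density p f i z)) = 
     (\<lambda>z. ennreal (besov_density p f i z) * indicator (ball 0 1) z)"
    by (auto simp: fun_eq_iff split: split_indicator)
  finally show ?thesis .
qed

section \<open>Local bounds for the derivative\<close>

text \<open>This takes the place of Hoelder's inequality. Where x exceeds t, the quotient x / t is
  at least 1 and hence at most its p-th power. If the integral of x^p is at most t^p, the second
  term integrates to at most t.\<close>

lemma le_weighted_powr:
  fixes x t p :: real
  assumes "p \<ge> 1" "x \<ge> 0" "t > 0"
  shows "x \<le> t + t powr (1 - p) * x powr p"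
proof (cases "x \<le> t")
  case True
  then show ?thesis by (simp add: add_increasing2)
next
  case False
  then have "1 \<le> x / t" using assms by simp
  then have "(x / t) powr 1 \<le> (x / t) powr p" using assms(1) by (intro powr_mono) auto
  then have "x / t \<le> x powr p / t powr p" using assms by (simp add: powr_divide)
  then have "x \<le> t * (x powr p / t powr p)" using assms(3) by (simp add: field_simps)
  also have "\<dots> = t powr (1 - p) * x powr p"
    using assms(3) by (simp add: powr_diff)
  finally show ?thesis using assms(3) by simp
qed

lemma besov_density_eq:
  assumes "z \<in> ball 0 1"
  shows "besov_density p f i z = (1 - (norm z)\<^sup>2) powr p / ((1 - (norm z)\<^sup>2)\<^sup>2 * pi) * norm (real_deriv f (slice_pt i z)) powr p"
proof -
  have "(norm z)\<^sup>2 < 1" using assms by (simp add: abs_square_less_1)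
  then show ?thesis by (simp add: besov_density_def powr_mult)
qed

text \<open>The exponent p - 2 of the combined weight may have either sign, so the weight is not
  estimated as a whole: its numerator is smallest at the radius \<open>R\<close>, and the square in
  its denominator is at most 1.\<close>

lemma powr_norm_le_besov_density:
  assumes "p > 0" "norm z \<le> R" "R < 1"
  shows "(1 - R\<^sup>2) powr p / pi * norm (real_deriv f (slice_pt i z)) powr p \<le> besov_density p f i z"
proof -
  have zR: "(norm z)\<^sup>2 \<le> R\<^sup>2" "R\<^sup>2 < 1"
    using assms order_trans[OF norm_ge_zero assms(2)] by (auto intro: power_mono simp: abs_square_less_1)
  have a: "(1 - R\<^sup>2) powr p \<le> (1 - (norm z)\<^sup>2) powr p"
    using zR assms(1) by (intro powr_mono2) auto
  have "(1 - (norm z)\<^sup>2)\<^sup>2 \<le> 1"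
    using zR by (intro power_le_one) auto
  then have "(1 - (norm z)\<^sup>2)\<^sup>2 * pi \<le> 1 * pi" by (intro mult_right_mono) auto
  then have le: "(1 - R\<^sup>2) powr p / pi \<le> (1 - (norm z)\<^sup>2) powr p / ((1 - (norm z)\<^sup>2)\<^sup>2 * pi)"
    using a zR by (intro frac_le) auto
  show ?thesis
    using assms mult_right_mono[OF le, of "norm (real_deriv f (slice_pt i z)) powr p"]
    by (subst besov_density_eq) auto
qed

text \<open>The area estimate is applied to each coordinate of the derivative on a square around
  \<open>z\<close>, on which the Besov weight has a positive lower bound. Allowing every positive
  \<open>t\<close> also covers a vanishing integral, although the estimate uses a negative power of
  \<open>t\<close>.\<close>

lemma real_deriv_bound:
  assumes p: "p > 1" and r: "0 \<le> r" "r < 1"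
  obtains C where "C \<ge> 0"
    "\<And>f i z t. slice_regular f \<Longrightarrow> i \<in> imag_units \<Longrightarrow> z \<in> cball 0 r \<Longrightarrow> t > 0 \<Longrightarrow>
       besov_integral p f i \<le> ennreal (t powr p) \<Longrightarrow> norm (real_deriv f (slice_pt i z)) \<le> C * t"
proof -
  \<comment> \<open>A point of the square with half side \<open>\<delta>\<close> has distance at
    most \<open>2 * \<delta>\<close> from \<open>z\<close>, and \<open>r + 2 * \<delta> = R\<close>.
    In \<open>C\<close>, the outer 4 and the denominator come from
    \<open>holomorphic_area_bound\<close>, \<open>4 * \<delta>\<^sup>2\<close> is the area of the
    square, and \<open>c\<close> is the lower bound of the weight.\<close>
  define \<delta> R where "\<delta> = (1 - r) / 4" and "R = (1 + r) / 2"
  define c where "c = (1 - R\<^sup>2) powr p / pi"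
  define C where "C = 4 * (4 * \<delta>\<^sup>2 + 1 / c) / (pi * \<delta>\<^sup>2)"
  have R: "0 \<le> R" "R < 1" "R\<^sup>2 < 1" using r by (auto simp: R_def abs_square_less_1)
  have d: "\<delta> > 0" using r by (simp add: \<delta>_def)
  have c: "c > 0" using R by (simp add: c_def)
  have C: "C \<ge> 0" using c by (simp add: C_def)
  have bound: "norm (slice_coord i (real_deriv f (slice_pt i z) * a)) \<le> C * t"
    if f: "slice_regular f" and i: "i \<in> imag_units" and z: "z \<in> cball 0 r" and t: "t > 0"
      and le: "besov_integral p f i \<le> ennreal (t powr p)" and a: "norm a = 1" for f i z t a
  proof -
    define h where "h w = real_deriv f (slice_pt i w)" for w
    define K where "K w = slice_coord i (h w * a)" for w
    define Q where "Q = cbox (z - Complex \<delta> \<delta>) (z + Complex \<delta> \<delta>)"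
    have Qn: "norm w \<le> R" if "w \<in> Q" for w
    proof -
      have "\<bar>Re (w - z)\<bar> \<le> \<delta>" "\<bar>Im (w - z)\<bar> \<le> \<delta>"
        using that by (auto simp: Q_def in_cbox_complex_iff)
      then have "norm (w - z) \<le> 2 * \<delta>" using cmod_le[of "w - z"] by linarith
      then show ?thesis
        using norm_triangle_sub[of w z] z by (auto simp: \<delta>_def R_def field_simps)
    qed
    have Qb: "Q \<subseteq> ball 0 1" using Qn R by force
    have pt: "ennreal (norm (K w)) * indicator Q w \<le> ennreal t * indicator Q w
        + ennreal (t powr (1 - p) / c) * (ennreal (besov_density p f i w) * indicator (ball 0 1) w)" for w
    proof (cases "w \<in> Q")
      case True
      have "norm (K w) \<le> norm (h w)"
        using norm_slice_coord_le[OF i, of "h w * a"] a by (simp add: K_def norm_mult)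
      also have "\<dots> \<le> t + t powr (1 - p) * norm (h w) powr p"
        using p t by (intro le_weighted_powr) auto
      also have "norm (h w) powr p \<le> besov_density p f i w / c"
        using powr_norm_le_besov_density[of p w R f i] p R Qn[OF True] c
        by (simp add: h_def field_simps c_def[symmetric])
      finally have "norm (K w) \<le> t + t powr (1 - p) / c * besov_density p f i w"
        by (simp add: mult_left_mono)
      then have "ennreal (norm (K w)) \<le> ennreal (t + t powr (1 - p) / c * besov_density p f i w)"
        by (rule ennreal_leI)
      also have "\<dots> = ennreal t + ennreal (t powr (1 - p) / c) * ennreal (besov_density p f i w)"
        using t c by (simp add: besov_density_nonneg ennreal_plus flip: ennreal_mult)
      finally show ?thesis using True Qb by (auto simp: indicator_def)
    qed simp
    have area: "ennreal (pi * \<delta>\<^sup>2 * norm (K z)) \<le> 4 * (\<integral>\<^sup>+w\<in>Q. ennreal (norm (K w)) \<partial>lborel)"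
      unfolding Q_def
      by (rule holomorphic_area_bound[where S="ball 0 1"])
         (use Qb d real_deriv_coord_holomorphic[OF f i] in \<open>auto simp: K_def[abs_def] h_def Q_def\<close>)
    have "(\<integral>\<^sup>+w\<in>Q. ennreal (norm (K w)) \<partial>lborel) \<le> (\<integral>\<^sup>+w. ennreal t * indicator Q w
        + ennreal (t powr (1 - p) / c) * (ennreal (besov_density p f i w) * indicator (ball 0 1) w) \<partial>lborel)"
      by (intro nn_integral_mono pt)
    also have "\<dots> = ennreal t * emeasure lborel Q + ennreal (t powr (1 - p) / c) * besov_integral p f i"
      using besov_density_measurable[OF f i] p
      by (simp add: nn_integral_add nn_integral_cmult besov_integral_eq[OF i] Q_def)
    also have "\<dots> \<le> ennreal t * ennreal (4 * \<delta>\<^sup>2) + ennreal (t powr (1 - p) / c) * ennreal (t powr p)"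
    proof (intro add_mono mult_left_mono le)
      show "emeasure lborel Q \<le> ennreal (4 * \<delta>\<^sup>2)"
        using d by (simp add: Q_def emeasure_lborel_cbox_eq Basis_complex_def power2_eq_square)
    qed auto
    also have "\<dots> = ennreal (t * (4 * \<delta>\<^sup>2 + 1 / c))"
    proof -
      have "t powr (1 - p) / c * t powr p = t / c"
        using t by (simp flip: powr_add)
      then show ?thesis
        using t c by (simp flip: ennreal_mult ennreal_plus) (simp add: algebra_simps)
    qed
    finally have "4 * (\<integral>\<^sup>+w\<in>Q. ennreal (norm (K w)) \<partial>lborel) \<le> 4 * ennreal (t * (4 * \<delta>\<^sup>2 + 1 / c))"
      by (rule mult_left_mono) simp
    also have "\<dots> = ennreal (4 * (t * (4 * \<delta>\<^sup>2 + 1 / c)))"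
      using ennreal_mult'[of 4 "t * (4 * \<delta>\<^sup>2 + 1 / c)"] by simp
    finally have "ennreal (pi * \<delta>\<^sup>2 * norm (K z)) \<le> ennreal (4 * (t * (4 * \<delta>\<^sup>2 + 1 / c)))"
      using area by (rule order_trans[rotated])
    then have "pi * \<delta>\<^sup>2 * norm (K z) \<le> 4 * (t * (4 * \<delta>\<^sup>2 + 1 / c))"
      using t c by (subst (asm) ennreal_le_iff) auto
    then have "norm (K z) \<le> C * t"
      using d by (simp add: C_def field_simps)
    then show ?thesis by (simp add: K_def h_def)
  qed
  show ?thesis
  \<comment> \<open>Each of the two coordinates contributes one \<open>C\<close>.\<close>
  proof (rule that[of "2 * C"])
    fix f i z t
    assume f: "slice_regular f" and i: "i \<in> imag_units" and z: "z \<in> cball (0::complex) r" and t: "t > 0"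
      and le: "besov_integral p f i \<le> ennreal (t powr p)"
    obtain j where j: "j \<in> imag_units" "j * i = - (i * j)"
      using orthogonal_imag_unit[OF i] .
    show "norm (real_deriv f (slice_pt i z)) \<le> 2 * C * t"
      using norm_le_slice_coords[OF i j, of "real_deriv f (slice_pt i z)"]
        bound[OF f i z t le, of 1] bound[OF f i z t le, of "- j"] norm_imag_unit[OF j(1)] by simp
  qed (use C in simp)
qed

section \<open>The triangle inequality\<close>

lemma besov_integral_le_sup: "i \<in> imag_units \<Longrightarrow> besov_integral p f i \<le> besov_sup p f"
  unfolding besov_sup_def by (rule SUP_upper)

lemma besov_sup_eq_powr:
  assumes "p > 0" "besov_sup p f < \<infinity>"
  shows "besov_sup p f = ennreal ((enn2real (besov_sup p f) powr (1 / p)) powr p)"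
  using assms by (simp add: powr_powr)

lemma enn2real_powr_inverse_le:
  assumes "p > 0" "s \<ge> 0" "x \<le> ennreal (s powr p)"
  shows "enn2real x powr (1 / p) \<le> s"
proof -
  have "enn2real x \<le> s powr p" using assms(3) by (simp add: enn2real_leI)
  then have "enn2real x powr (1 / p) \<le> (s powr p) powr (1 / p)"
    using assms by (intro powr_mono2) auto
  then show ?thesis using assms by (simp add: powr_powr)
qed

text \<open>Convexity on the open half-line settles positive \<open>u\<close> and \<open>v\<close>.
  If one of them is 0, the claim reduces to c^p <= c for c between 0 and 1.\<close>

lemma powr_convex_atLeast_0:
  fixes u v a b p :: real
  assumes p: "p \<ge> 1" and "u \<ge> 0" "v \<ge> 0" "a \<ge> 0" "b \<ge> 0" "a + b = 1"
  shows "(a * u + b * v) powr p \<le> a * u powr p + b * v powr p"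
proof -
  have zero: "(c * w) powr p \<le> c * w powr p" if "0 \<le> c" "c \<le> 1" "0 \<le> w" for c w
  proof -
    have "c powr p \<le> c powr 1" using that p by (intro powr_mono') auto
    then show ?thesis using that by (simp add: powr_mult mult_right_mono)
  qed
  show ?thesis
  proof (cases "u = 0 \<or> v = 0")
    case True
    then show ?thesis using zero[of a u] zero[of b v] assms by auto
  next
    case False
    then have "u \<in> {0<..}" "v \<in> {0<..}" using assms by auto
    then have "(a *\<^sub>R u + b *\<^sub>R v) powr p \<le> a * u powr p + b * v powr p"
      using powr_convex[OF p] assms by (metis convex_on_def)
    then show ?thesis by simp
  qed
qed

text \<open>Here x + y is s + t times the convex combination of x / s and y / t with weights s / (s
  + t) and t / (s + t). The coefficients are such that bounds s^p and t^p for the two p-th powers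
  add up to (s + t)^p.\<close>

lemma powr_add_le_weighted:
  fixes x y s t p :: real
  assumes p: "p \<ge> 1" and nn: "x \<ge> 0" "y \<ge> 0" and st: "s > 0" "t > 0"
  shows "(x + y) powr p \<le> (s + t) powr p * (s / (s + t)) / s powr p * x powr p
    + (s + t) powr p * (t / (s + t)) / t powr p * y powr p"
proof -
  have "x + y = (s + t) * (s / (s + t) * (x / s) + t / (s + t) * (y / t))"
    using st by (simp flip: add_divide_distrib)
  then have "(x + y) powr p = (s + t) powr p * (s / (s + t) * (x / s) + t / (s + t) * (y / t)) powr p"
    using st nn by (simp only: powr_mult)
  also have "\<dots> \<le> (s + t) powr p * (s / (s + t) * (x / s) powr p + t / (s + t) * (y / t) powr p)"
    using st nn by (intro mult_left_mono powr_convex_atLeast_0 p) (auto simp flip: add_divide_distrib)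
  finally show ?thesis
    using st nn by (simp add: powr_divide distrib_left)
qed

text \<open>Minkowski's inequality in a form that passes to the supremum over \<open>i\<close>: the bounds \<open>s\<close> and \<open>t\<close>
  are also the weights of the convex combination to which convexity of the power is applied.\<close>

lemma besov_integral_add:
  assumes p: "p > 1" and f: "slice_regular f" and g: "slice_regular g" and i: "i \<in> imag_units"
    and st: "s > 0" "t > 0"
    and le: "besov_integral p f i \<le> ennreal (s powr p)" "besov_integral p g i \<le> ennreal (t powr p)"
  shows "besov_integral p (\<lambda>q. f q + g q) i \<le> ennreal ((s + t) powr p)"
proof -
  define \<alpha> where "\<alpha> = (s + t) powr p * (s / (s + t)) / s powr p"
  define \<beta> where "\<beta> = (s + t) powr p * (t / (s + t)) / t powr p"
  have nn: "\<alpha> \<ge> 0" "\<beta> \<ge> 0" using st by (auto simp: \<alpha>_def \<beta>_def)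
  have pt: "ennreal (besov_density p (\<lambda>q. f q + g q) i z) * indicator (ball 0 1) z \<le>
     ennreal \<alpha> * (ennreal (besov_density p f i z) * indicator (ball 0 1) z) +
     ennreal \<beta> * (ennreal (besov_density p g i z) * indicator (ball 0 1) z)" for z
  proof (cases "z \<in> ball 0 1")
    case True
    define w where "w = (1 - (norm z)\<^sup>2) powr p / ((1 - (norm z)\<^sup>2)\<^sup>2 * pi)"
    define a b where "a = norm (real_deriv f (slice_pt i z))" and "b = norm (real_deriv g (slice_pt i z))"
    have q: "slice_pt i z \<in> ball 0 1" using True i by (simp add: norm_slice_pt)
    have "norm (real_deriv (\<lambda>q. f q + g q) (slice_pt i z)) powr p \<le> (a + b) powr p"
      unfolding real_deriv_add[OF f g q] a_def b_def
      using p by (intro powr_mono2 norm_triangle_ineq) auto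
    also have "\<dots> \<le> \<alpha> * a powr p + \<beta> * b powr p"
      unfolding \<alpha>_def \<beta>_def using p st by (intro powr_add_le_weighted) (auto simp: a_def b_def)
    finally have "w * norm (real_deriv (\<lambda>q. f q + g q) (slice_pt i z)) powr p \<le> w * (\<alpha> * a powr p + \<beta> * b powr p)"
      by (rule mult_left_mono) (simp add: w_def)
    then have "besov_density p (\<lambda>q. f q + g q) i z \<le> \<alpha> * besov_density p f i z + \<beta> * besov_density p g i z"
      unfolding besov_density_eq[OF True] w_def[symmetric] a_def[symmetric] b_def[symmetric]
      by (simp add: algebra_simps)
    then have "ennreal (besov_density p (\<lambda>q. f q + g q) i z) \<le> ennreal (\<alpha> * besov_density p f i z + \<beta> * besov_density p g i z)"
      by (rule ennreal_leI)
    then show ?thesis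
      using True nn by (simp add: besov_density_nonneg ennreal_mult)
  qed simp
  have "besov_integral p (\<lambda>q. f q + g q) i \<le>
     (\<integral>\<^sup>+z. ennreal \<alpha> * (ennreal (besov_density p f i z) * indicator (ball 0 1) z) +
     ennreal \<beta> * (ennreal (besov_density p g i z) * indicator (ball 0 1) z) \<partial>lborel)"
    unfolding besov_integral_eq[OF i] by (intro nn_integral_mono pt)
  also have "\<dots> = ennreal \<alpha> * besov_integral p f i + ennreal \<beta> * besov_integral p g i"
    using besov_density_measurable[OF f i, of p] besov_density_measurable[OF g i, of p] p
    by (simp add: nn_integral_add nn_integral_cmult besov_integral_eq[OF i])
  also have "\<dots> \<le> ennreal \<alpha> * ennreal (s powr p) + ennreal \<beta> * ennreal (t powr p)"
    by (intro add_mono mult_left_mono le) auto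
  also have "\<dots> = ennreal (\<alpha> * s powr p + \<beta> * t powr p)"
    using nn by (simp add: ennreal_mult)
  also have "\<alpha> * s powr p + \<beta> * t powr p = (s + t) powr p * (s / (s + t) + t / (s + t))"
    using st by (simp add: \<alpha>_def \<beta>_def distrib_left)
  also have "s / (s + t) + t / (s + t) = 1" using st by (simp flip: add_divide_distrib)
  finally show ?thesis by simp
qed

lemma besov_sup_add:
  assumes "p > 1" "slice_regular f" "slice_regular g" "s > 0" "t > 0"
    "besov_sup p f \<le> ennreal (s powr p)" "besov_sup p g \<le> ennreal (t powr p)"
  shows "besov_sup p (\<lambda>q. f q + g q) \<le> ennreal ((s + t) powr p)"
  unfolding besov_sup_def
  using assms by (auto intro!: SUP_least besov_integral_add intro: order_trans[OF besov_integral_le_sup])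

lemma besov_sup_uminus: "besov_sup p (\<lambda>q. - f q) = besov_sup p f"
  by (simp add: besov_sup_def besov_integral_def norm_real_deriv_uminus)

lemma besov_norm_uminus: "besov_norm p (\<lambda>q. - f q) = besov_norm p f"
  by (simp add: besov_norm_def besov_sup_uminus)

lemma besov_norm_nonneg: "0 \<le> besov_norm p f"
  by (simp add: besov_norm_def)

text \<open>The difference in the hypothesis is the seminorm, the p-th root of the supremum. The
  strict inequality forces \<open>s\<close> to be positive even where the seminorm vanishes; the
  weighted estimates divide by such bounds.\<close>

lemma besov_sup_le_powr:
  assumes "p > 0" "f \<in> besov p" "s > besov_norm p f - norm (f 0)"
  shows "besov_sup p f \<le> ennreal (s powr p)"
proof -
  have fin: "besov_sup p f < \<infinity>" using assms(2) by (simp add: besov_def)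
  have "besov_sup p f = ennreal ((enn2real (besov_sup p f) powr (1 / p)) powr p)"
    by (rule besov_sup_eq_powr[OF assms(1) fin])
  also have "\<dots> \<le> ennreal (s powr p)"
    using assms by (intro ennreal_leI powr_mono2) (auto simp: besov_norm_def)
  finally show ?thesis .
qed

lemma besov_add:
  assumes p: "p > 1" and f: "f \<in> besov p" and g: "g \<in> besov p"
  shows "(\<lambda>q. f q + g q) \<in> besov p"
    and "besov_norm p (\<lambda>q. f q + g q) \<le> besov_norm p f + besov_norm p g"
proof -
  \<comment> \<open>The summand keeps both bounds positive when a seminorm is 0. Any positive value
    yields finiteness, and letting it tend to 0 yields the norm inequality.\<close>
  let ?s = "\<lambda>\<epsilon>. besov_norm p f - norm (f 0) + \<epsilon>" and ?t = "\<lambda>\<epsilon>. besov_norm p g - norm (g 0) + \<epsilon>"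
  have nn: "besov_norm p f - norm (f 0) \<ge> 0" "besov_norm p g - norm (g 0) \<ge> 0"
    by (simp_all add: besov_norm_def)
  have reg: "slice_regular f" "slice_regular g" using f g by (auto simp: besov_def)
  have le: "besov_sup p (\<lambda>q. f q + g q) \<le> ennreal ((?s \<epsilon> + ?t \<epsilon>) powr p)" if "\<epsilon> > 0" for \<epsilon>
    using nn that p by (intro besov_sup_add p reg besov_sup_le_powr f g) auto
  from le[of 1] show "(\<lambda>q. f q + g q) \<in> besov p"
    using f g slice_regular_add[OF reg] by (auto simp: besov_def intro: le_less_trans)
  show "besov_norm p (\<lambda>q. f q + g q) \<le> besov_norm p f + besov_norm p g"
  proof (rule field_le_epsilon)
    fix e :: real assume e: "e > 0"
    have "enn2real (besov_sup p (\<lambda>q. f q + g q)) powr (1 / p) \<le> ?s (e/2) + ?t (e/2)"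
      using nn e p le[of "e/2"] by (intro enn2real_powr_inverse_le) auto
    then show "besov_norm p (\<lambda>q. f q + g q) \<le> besov_norm p f + besov_norm p g + e"
      using norm_triangle_ineq[of "f 0" "g 0"] by (simp add: besov_norm_def)
  qed
qed

lemma besov_uminus: "f \<in> besov p \<Longrightarrow> (\<lambda>q. - f q) \<in> besov p"
  by (simp add: besov_def slice_regular_uminus besov_sup_uminus)

lemma besov_diff:
  assumes p: "p > 1" and f: "f \<in> besov p" and g: "g \<in> besov p"
  shows "(\<lambda>q. f q - g q) \<in> besov p"
    and "besov_norm p (\<lambda>q. f q - g q) \<le> besov_norm p f + besov_norm p g"
  using besov_add[OF p f besov_uminus[OF g]] by (simp_all add: besov_norm_uminus)

lemma besov_zero: "(\<lambda>q. 0) \<in> besov p" "besov_norm p (\<lambda>q. 0) = 0"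
proof -
  have "besov_sup p (\<lambda>q. 0) = 0"
    unfolding besov_sup_def by (intro antisym SUP_least) (simp_all add: besov_integral_def real_deriv_zero)
  then show "(\<lambda>q. 0) \<in> besov p" "besov_norm p (\<lambda>q. 0) = 0"
    by (simp_all add: besov_def besov_norm_def slice_regular_zero)
qed

section \<open>Point evaluations and the metric\<close>

text \<open>Every point lies on a slice, and the segment from 0 to it stays on that slice, so the
  mean value inequality turns the derivative bound into a bound for f(q) - f(0). Since the
  derivative bound is the same for all slices, so is the result.\<close>

lemma besov_bound:
  assumes p: "p > 1" and r: "0 \<le> r" "r < 1"
  obtains C where "C \<ge> 0" "\<And>f q. f \<in> besov p \<Longrightarrow> q \<in> cball 0 r \<Longrightarrow> norm (f q) \<le> C * besov_norm p f"
proof -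
  obtain C where C: "C \<ge> 0" "\<And>f i z t. slice_regular f \<Longrightarrow> i \<in> imag_units \<Longrightarrow> z \<in> cball 0 r \<Longrightarrow> t > 0 \<Longrightarrow>
       besov_integral p f i \<le> ennreal (t powr p) \<Longrightarrow> norm (real_deriv f (slice_pt i z)) \<le> C * t"
    using real_deriv_bound[OF p r] by blast
  show ?thesis
  proof (rule that[of "1 + C"])
    fix f q assume f: "f \<in> besov p" and q: "q \<in> cball (0::quat) r"
    obtain i where i: "i \<in> imag_units" "q = slice_pt i (Complex (qre q) (norm (quat_im q)))"
      by (rule quat_on_slice)
    define z where "z = Complex (qre q) (norm (quat_im q))"
    have qz: "q = slice_pt i z" using i by (simp add: z_def)
    have z: "norm z \<le> r" using q by (simp add: qz norm_slice_pt[OF i(1)])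
    have reg: "slice_regular f" using f by (simp add: besov_def)
    have "norm (f q) \<le> (1 + C) * besov_norm p f + C * e" if e: "e > 0" for e
    proof -
      define t where "t = besov_norm p f - norm (f 0) + e"
      have t: "t > 0" using e by (simp add: t_def besov_norm_def add_nonneg_pos)
      have "besov_integral p f i \<le> ennreal (t powr p)"
        by (rule order_trans[OF besov_integral_le_sup besov_sup_le_powr])
           (use i p f e in \<open>auto simp: t_def\<close>)
      note b = C(2)[OF reg i(1) _ t this]
      have "norm (f (slice_pt i z) - f (slice_pt i 0)) \<le> (C * t) * norm (z - 0)"
      proof (rule differentiable_bound[of "cball 0 r" "\<lambda>z. f (slice_pt i z)"])
        fix w :: complex assume w: "w \<in> cball 0 r"
        then have "w \<in> ball 0 1" using r by auto
        then show "((\<lambda>z. f (slice_pt i z)) has_derivative (\<lambda>v. slice_pt i v * real_deriv f (slice_pt i w))) (at w within cball 0 r)"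
          by (rule has_derivative_at_withinI[OF slice_regular_has_slice_derivative[OF reg i(1)]])
        show "onorm (\<lambda>v. slice_pt i v * real_deriv f (slice_pt i w)) \<le> C * t"
          by (rule onorm_bound)
             (use C(1) t b[OF w] in \<open>auto simp: norm_mult norm_slice_pt[OF i(1)] mult.commute mult_left_mono\<close>)
      qed (use z r in auto)
      also have "\<dots> \<le> (C * t) * 1"
        using z r C(1) t by (intro mult_left_mono) auto
      finally have "norm (f q) \<le> norm (f 0) + C * t"
        using norm_triangle_sub[of "f q" "f 0"] by (simp add: qz slice_pt_linear_simps)
      also have "\<dots> \<le> besov_norm p f + C * (besov_norm p f + e)"
        using C(1) by (intro add_mono mult_left_mono) (auto simp: t_def besov_norm_def)
      finally show ?thesis by (simp add: algebra_simps)
    qed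
    note * = this
    show "norm (f q) \<le> (1 + C) * besov_norm p f"
    proof (rule field_le_epsilon)
      fix e :: real assume e: "e > 0"
      \<comment> \<open>Dividing by \<open>C + 1\<close> instead of \<open>C\<close> also covers
        \<open>C = 0\<close>.\<close>
      have "norm (f q) \<le> (1 + C) * besov_norm p f + C * (e / (C + 1))"
        using C(1) e by (intro *) auto
      also have "C * (e / (C + 1)) \<le> e" using C(1) e by (simp add: field_simps)
      finally show "norm (f q) \<le> (1 + C) * besov_norm p f + e" by simp
    qed
  qed (use C in simp)
qed

text \<open>In the ball this is the bound for point evaluations, outside it the normalization of the
  elements to 0. Together they make the distance separate total functions.\<close>

lemma besov_norm_eq_0_imp:
  assumes p: "p > 1" and f: "f \<in> besov p" and 0: "besov_norm p f = 0"
  shows "f q = 0"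
proof (cases "q \<in> ball 0 1")
  case True
  show ?thesis
  proof (rule besov_bound[OF p norm_ge_zero[of q]])
    show "norm q < 1" using True by simp
    fix C assume "\<And>f q'. f \<in> besov p \<Longrightarrow> q' \<in> cball 0 (norm q) \<Longrightarrow> norm (f q') \<le> C * besov_norm p f"
    from this[OF f, of q] show "f q = 0" using 0 by simp
  qed
next
  case False
  then show ?thesis using f by (simp add: besov_def)
qed

lemma Metric_space_besov:
  assumes p: "p > 1"
  shows "Metric_space (besov p) (\<lambda>f g. besov_norm p (\<lambda>q. f q - g q))"
proof
  fix f g h :: "quat \<Rightarrow> quat"
  show "0 \<le> besov_norm p (\<lambda>q. f q - g q)" by (rule besov_norm_nonneg)
  show "besov_norm p (\<lambda>q. f q - g q) = besov_norm p (\<lambda>q. g q - f q)"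
    using besov_norm_uminus[of p "\<lambda>q. f q - g q"] by simp
  assume f: "f \<in> besov p" and g: "g \<in> besov p"
  show "besov_norm p (\<lambda>q. f q - g q) = 0 \<longleftrightarrow> f = g"
    using besov_norm_eq_0_imp[OF p besov_diff(1)[OF p f g]] by (auto simp: besov_zero)
  assume h: "h \<in> besov p"
  show "besov_norm p (\<lambda>q. f q - h q) \<le> besov_norm p (\<lambda>q. f q - g q) + besov_norm p (\<lambda>q. g q - h q)"
    using besov_add(2)[OF p besov_diff(1)[OF p f g] besov_diff(1)[OF p g h]] by simp
qed

section \<open>Slice extension and the representation formula\<close>

text \<open>The formula inside \<open>slice_comp\<close>, with an arbitrary function
  \<open>g\<close> on the disk. In this generality it also expresses the representation formula and
  builds the limit in Montel's theorem.\<close>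

definition slice_ext :: "quat \<Rightarrow> (complex \<Rightarrow> quat) \<Rightarrow> quat \<Rightarrow> quat" where
  "slice_ext i g q = (1 / 2) *\<^sub>R
     ((1 - quat_im q /\<^sub>R norm (quat_im q) * i) * g (Complex (qre q) (norm (quat_im q))) +
      (1 + quat_im q /\<^sub>R norm (quat_im q) * i) * g (Complex (qre q) (- norm (quat_im q))))"

lemma slice_comp_eq_slice_ext:
  "slice_comp i \<Phi> f q = (if q \<in> ball 0 1 then slice_ext i (\<lambda>z. f (\<Phi> (slice_pt i z))) q else 0)"
  by (simp add: slice_comp_def slice_ext_def Let_def)

lemma half_sum_eq: "(1 / 2) *\<^sub>R ((1 - a) * x + (1 + a) * x) = (x :: quat)"
  by (simp flip: distrib_right)

text \<open>The definition always uses a point with nonnegative imaginary part. Below the real axis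
  the unit of the slice point is \<open>- J\<close>, which merely exchanges the two summands; on the
  axis \<open>J\<close> cancels. The formula thus holds without a condition on the sign.\<close>

lemma slice_ext_slice_pt:
  assumes J: "J \<in> imag_units"
  shows "slice_ext i g (slice_pt J z) = (1 / 2) *\<^sub>R ((1 - J * i) * g z + (1 + J * i) * g (cnj z))"
proof -
  consider "Im z = 0" | "Im z > 0" | "Im z < 0" by linarith
  then show ?thesis
  proof cases
    case 1
    then have "Complex (Re z) 0 = z" "cnj z = z" by (simp_all add: complex_eq_iff)
    then show ?thesis
      using 1 half_sum_eq[of 0] half_sum_eq[of "J * i"]
      by (simp only: slice_ext_def quat_im_slice_pt[OF J] qre_slice_pt[OF J]) simp
  next
    case 2
    then have "Complex (Re z) (- Im z) = cnj z" by (simp add: complex_eq_iff)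
    then show ?thesis
      using 2 by (simp add: slice_ext_def quat_im_slice_pt[OF J] qre_slice_pt[OF J] norm_imag_unit[OF J])
  next
    case 3
    then have "Complex (Re z) (- Im z) = cnj z" by (simp add: complex_eq_iff)
    then show ?thesis
      using 3 by (simp add: slice_ext_def quat_im_slice_pt[OF J] qre_slice_pt[OF J] norm_imag_unit[OF J] add.commute)
  qed
qed

lemma slice_ext_diff: "slice_ext i (\<lambda>z. g z - h z) q = slice_ext i g q - slice_ext i h q"
  by (simp add: slice_ext_def right_diff_distrib scaleR_diff_right scaleR_add_right)

lemma slice_ext_add: "slice_ext i (\<lambda>z. g z + h z) q = slice_ext i g q + slice_ext i h q"
  by (simp add: slice_ext_def distrib_left scaleR_add_right)

lemma slice_ext_mult_right: "slice_ext i (\<lambda>z. g z * a) q = slice_ext i g q * a"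
  by (simp add: slice_ext_def distrib_right mult.assoc)

lemma norm_half_combination_le:
  assumes "norm a \<le> 1"
  shows "norm ((1 / 2) *\<^sub>R ((1 - a) * x + (1 + a) * y)) \<le> norm x + norm (y :: quat)"
proof -
  have "norm (1 - a) \<le> 2" "norm (1 + a) \<le> 2"
    using assms norm_triangle_ineq4[of 1 a] norm_triangle_ineq[of 1 a] by auto
  then have "norm ((1 - a) * x) \<le> 2 * norm x" "norm ((1 + a) * y) \<le> 2 * norm y"
    by (auto simp: norm_mult intro: mult_right_mono)
  then have "norm ((1 - a) * x + (1 + a) * y) \<le> 2 * norm x + 2 * norm y"
    by (intro order_trans[OF norm_triangle_ineq] add_mono)
  then show ?thesis by simp
qed

lemma norm_slice_ext_le:
  assumes i: "i \<in> imag_units"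
  shows "norm (slice_ext i g q) \<le> norm (g (Complex (qre q) (norm (quat_im q)))) + norm (g (Complex (qre q) (- norm (quat_im q))))"
  unfolding slice_ext_def
  by (rule norm_half_combination_le; cases "quat_im q = 0") (simp_all add: norm_mult norm_imag_unit[OF i])

lemma norm_Complex_qre_quat_im:
  "norm (Complex (qre q) (norm (quat_im q))) = norm q" "norm (Complex (qre q) (- norm (quat_im q))) = norm q"
  by (simp_all add: cmod_def norm_quat quat_im_def)

section \<open>Regularity of the extension\<close>

text \<open>Both identities rest on J i i = - J. Left multiplication by 1 - J i carries the complex
  structure i to J, and left multiplication by 1 + J i carries - i to J; this is why the extension
  of a function holomorphic for i is holomorphic for every J.\<close>

lemma slice_intertwine:
  assumes i: "i \<in> imag_units" and J: "J \<in> imag_units"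
  shows "(1 - J * i) * slice_pt i w = slice_pt J w * (1 - J * i)"
    and "(1 + J * i) * slice_pt i (cnj w) = slice_pt J w * (1 + J * i)"
proof -
  have "J * i * i = - J" using imag_unit_mult_self[OF i] by (simp add: mult.assoc)
  then show "(1 - J * i) * slice_pt i w = slice_pt J w * (1 - J * i)"
    and "(1 + J * i) * slice_pt i (cnj w) = slice_pt J w * (1 + J * i)"
    by (simp_all add: slice_pt_alt of_real_def distrib_left distrib_right left_diff_distrib right_diff_distrib
      imag_unit_mult_self_left[OF J] scaleR_add_right scaleR_diff_right)
qed

lemma slice_ext_slice_pt_has_derivative:
  assumes i: "i \<in> imag_units" and J: "J \<in> imag_units"
    and c: "(g has_derivative (\<lambda>w. slice_pt i w * c)) (at z)"
    and d: "(g has_derivative (\<lambda>w. slice_pt i w * d)) (at (cnj z))"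
  shows "((\<lambda>z. slice_ext i g (slice_pt J z)) has_derivative
    (\<lambda>w. slice_pt J w * ((1 / 2) *\<^sub>R ((1 - J * i) * c + (1 + J * i) * d)))) (at z)"
proof -
  have "((\<lambda>z. (1 / 2) *\<^sub>R ((1 - J * i) * g z + (1 + J * i) * g (cnj z))) has_derivative
     (\<lambda>w. (1 / 2) *\<^sub>R ((1 - J * i) * (slice_pt i w * c) + (1 + J * i) * (slice_pt i (cnj w) * d)))) (at z)"
    by (intro has_derivative_scaleR_right has_derivative_add has_derivative_mult_right c
        has_derivative_compose[OF bounded_linear_imp_has_derivative[OF bounded_linear_cnj] d])
  moreover have "(1 - J * i) * (slice_pt i w * c) = slice_pt J w * ((1 - J * i) * c)"
    "(1 + J * i) * (slice_pt i (cnj w) * d) = slice_pt J w * ((1 + J * i) * d)" for w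
    by (simp_all only: mult.assoc[symmetric] slice_intertwine[OF i J])
  ultimately show ?thesis
    by (simp only: slice_ext_slice_pt[OF J] mult_scaleR_right distrib_left)
qed

lemma bounded_linear_qre: "bounded_linear qre"
  by (rule bounded_linear_intro[where K=1]) (auto simp: norm_quat intro!: real_le_rsqrt)

lemma bounded_linear_quat_im: "bounded_linear quat_im"
  by (rule bounded_linear_intro[where K=1])
     (auto simp: quat_im_def quat_eq_iff norm_quat)

text \<open>Off the real axis the norm of the imaginary part is differentiable and nonzero, so the
  chain rule applies to the formula itself.\<close>

lemma slice_ext_differentiable_nonreal:
  assumes g: "\<And>z. z \<in> ball 0 1 \<Longrightarrow> g differentiable at z" and q: "q \<in> ball 0 1" "quat_im q \<noteq> 0"
  shows "slice_ext i g differentiable at q"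
proof -
  have 1: "qre differentiable at q" "quat_im differentiable at q"
    using bounded_linear_imp_differentiable bounded_linear_qre bounded_linear_quat_im by blast+
  have 2: "(\<lambda>q. norm (quat_im q)) differentiable at q"
    by (rule differentiable_compose[OF differentiable_norm_at[OF q(2)] 1(2)])
  have 3: "(\<lambda>q. inverse (norm (quat_im q))) differentiable at q"
    by (rule differentiable_inverse[OF 2]) (use q in simp)
  have 4: "(\<lambda>q. Complex (qre q) (norm (quat_im q))) differentiable at q"
    "(\<lambda>q. Complex (qre q) (- norm (quat_im q))) differentiable at q"
    unfolding Complex_eq
    by (intro derivative_intros differentiable_compose[OF bounded_linear_imp_differentiable[OF bounded_linear_of_real]] 1 2)+
  have 5: "(\<lambda>q. g (Complex (qre q) (norm (quat_im q)))) differentiable at q"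
    "(\<lambda>q. g (Complex (qre q) (- norm (quat_im q)))) differentiable at q"
    by (rule differentiable_compose[OF g 4(1)] differentiable_compose[OF g 4(2)];
      use q in \<open>simp add: norm_Complex_qre_quat_im\<close>)+
  show ?thesis
    unfolding slice_ext_def[abs_def]
    by (intro differentiable_add differentiable_diff differentiable_mult differentiable_scaleR differentiable_const 1 3 5)
qed

text \<open>The chain rule fails here, because the norm of the imaginary part is not differentiable
  at real points. Instead the intertwining relations show that the remainder of the extension is a
  combination of the remainders \<open>R\<close> at \<open>z\<close> and \<open>cnj z\<close>, which
  are both as far from \<open>x\<close> as \<open>q\<close> is.\<close>

lemma slice_ext_has_derivative_real:
  assumes i: "i \<in> imag_units" and c: "(g has_derivative (\<lambda>w. slice_pt i w * c)) (at (of_real x))"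
  shows "(slice_ext i g has_derivative (\<lambda>h. h * c)) (at (of_real x))"
  unfolding has_derivative_at_alt
proof (intro conjI allI impI)
  show "bounded_linear (\<lambda>h. h * c)" by (rule bounded_linear_mult_left)
  fix e :: real assume "e > 0"
  define R where "R w = g w - g (of_real x) - slice_pt i (w - of_real x) * c" for w
  \<comment> \<open>Half of \<open>e\<close> for each of the two remainders.\<close>
  obtain d where d: "d > 0" "\<And>w. norm (w - of_real x) < d \<Longrightarrow> norm (R w) \<le> e / 2 * norm (w - of_real x)"
    using c \<open>e > 0\<close> unfolding has_derivative_at_alt R_def by (meson half_gt_zero)
  have "norm (slice_ext i g q - slice_ext i g (of_real x) - (q - of_real x) * c) \<le> e * norm (q - of_real x)"
    if q: "norm (q - of_real x) < d" for q
  proof -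
    obtain J where J: "J \<in> imag_units" "q = slice_pt J (Complex (qre q) (norm (quat_im q)))"
      by (rule quat_on_slice)
    define z where "z = Complex (qre q) (norm (quat_im q))"
    have qz: "q = slice_pt J z" using J by (simp add: z_def)
    have qx: "q - of_real x = slice_pt J (z - of_real x)" by (simp add: qz slice_pt_linear_simps)
    have n: "norm (z - of_real x) = norm (q - of_real x)"
      by (simp add: qx norm_slice_pt[OF J(1)])
    have n': "norm (cnj z - of_real x) = norm (q - of_real x)"
      unfolding n[symmetric] by (metis complex_cnj_complex_of_real complex_cnj_diff complex_mod_cnj)
    \<comment> \<open>The value at \<open>x\<close> and the linear part are rewritten with the
      coefficients belonging to the unit \<open>J\<close> of \<open>q\<close>, so that all terms can
      be collected under them.\<close>
    have "slice_ext i g (of_real x) = g (of_real x)"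
      using slice_ext_slice_pt[OF J(1), of i g "of_real x"] by (simp add: half_sum_eq)
    also have "\<dots> = (1 / 2) *\<^sub>R ((1 - J * i) * g (of_real x) + (1 + J * i) * g (of_real x))"
      by (rule half_sum_eq[symmetric])
    finally have e1: "slice_ext i g (of_real x) = (1 / 2) *\<^sub>R ((1 - J * i) * g (of_real x) + (1 + J * i) * g (of_real x))" .
    have "(q - of_real x) * c = slice_pt J (z - of_real x) * ((1 / 2) *\<^sub>R ((1 - J * i) * c + (1 + J * i) * c))"
      by (simp only: qx half_sum_eq)
    also have "\<dots> = (1 / 2) *\<^sub>R ((1 - J * i) * (slice_pt i (z - of_real x) * c) + (1 + J * i) * (slice_pt i (cnj z - of_real x) * c))"
      using slice_intertwine[OF i J(1), of "z - of_real x"]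
      by (simp add: mult_scaleR_right distrib_left flip: mult.assoc)
    finally have "slice_ext i g q - slice_ext i g (of_real x) - (q - of_real x) * c =
       (1 / 2) *\<^sub>R ((1 - J * i) * R z + (1 + J * i) * R (cnj z))"
      unfolding e1 qz slice_ext_slice_pt[OF J(1)] R_def
      by (simp only: right_diff_distrib scaleR_add_right scaleR_diff_right) simp
    also have "norm \<dots> \<le> norm (R z) + norm (R (cnj z))"
      by (rule norm_half_combination_le) (simp add: norm_mult norm_imag_unit i J)
    also have "\<dots> \<le> e * norm (q - of_real x)"
      using d(2)[of z] d(2)[of "cnj z"] q n n' by simp
    finally show ?thesis .
  qed
  then show "\<exists>d>0. \<forall>q. norm (q - of_real x) < d \<longrightarrow>
     norm (slice_ext i g q - slice_ext i g (of_real x) - (q - of_real x) * c) \<le> e * norm (q - of_real x)"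
    using d(1) by blast
qed

text \<open>Agreement with the extension is asked for on the ball only, so that \<open>F\<close> may
  be cut off to 0 outside, as the Besov space demands.\<close>

lemma slice_regular_slice_ext:
  assumes i: "i \<in> imag_units"
    and g: "\<And>z. z \<in> ball 0 1 \<Longrightarrow> \<exists>c. (g has_derivative (\<lambda>w. slice_pt i w * c)) (at z)"
    and F: "\<And>q. q \<in> ball 0 1 \<Longrightarrow> F q = slice_ext i g q"
  shows "slice_regular F"
proof (rule slice_regularI)
  show "F differentiable_on ball 0 1"
    unfolding differentiable_on_def
  proof
    fix q :: quat assume q: "q \<in> ball 0 1"
    have "slice_ext i g differentiable at q"
    proof (cases "quat_im q = 0")
      case True
      then have qr: "q = of_real (qre q)" by (simp add: quat_im_def quat_eq_iff of_real_def)
      then have "\<bar>qre q\<bar> < 1" using q by (metis mem_ball_0 norm_of_real)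
      then obtain c where "(g has_derivative (\<lambda>w. slice_pt i w * c)) (at (of_real (qre q)))"
        using g[of "of_real (qre q)"] by auto
      from slice_ext_has_derivative_real[OF i this] show ?thesis
        using qr by (auto simp: differentiable_def)
    next
      case False
      then show ?thesis
        using g q by (intro slice_ext_differentiable_nonreal) (auto simp: differentiable_def)
    qed
    then obtain D where "(slice_ext i g has_derivative D) (at q)" by (auto simp: differentiable_def)
    then have "(F has_derivative D) (at q)"
      by (rule has_derivative_transform_within_open[OF _ open_ball q]) (simp only: F)
    then have "F differentiable at q" by (auto simp: differentiable_def)
    then show "F differentiable at q within ball 0 1"
      by (rule differentiable_at_withinI)
  qed
  fix J z assume J: "J \<in> imag_units" and z: "z \<in> ball (0::complex) 1"
  then have "cnj z \<in> ball 0 1" by simp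
  with z obtain c d where "(g has_derivative (\<lambda>w. slice_pt i w * c)) (at z)"
    "(g has_derivative (\<lambda>w. slice_pt i w * d)) (at (cnj z))"
    using g by blast
  from slice_ext_slice_pt_has_derivative[OF i J this]
  have "((\<lambda>z. F (slice_pt J z)) has_derivative
    (\<lambda>w. slice_pt J w * ((1 / 2) *\<^sub>R ((1 - J * i) * c + (1 + J * i) * d)))) (at z)"
    by (rule has_derivative_transform_within_open[OF _ open_ball z])
       (use F in \<open>simp add: norm_slice_pt[OF J]\<close>)
  then show "\<exists>c. ((\<lambda>z. F (slice_pt J z)) has_derivative (\<lambda>w. slice_pt J w * c)) (at z)" by blast
qed

text \<open>Identity principle: all slices share the real axis, where \<open>f\<close> and the
  extension agree. On the slice through \<open>q\<close> both coordinates of their difference are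
  holomorphic and vanish on a real interval, hence throughout the disk.\<close>

theorem slice_representation:
  assumes f: "slice_regular f" and i: "i \<in> imag_units" and q: "q \<in> ball 0 1"
  shows "f q = slice_ext i (\<lambda>z. f (slice_pt i z)) q"
proof -
  define F where "F = slice_ext i (\<lambda>z. f (slice_pt i z))"
  have F: "slice_regular F"
    by (rule slice_regular_slice_ext[OF i]) (use slice_regular_has_slice_derivative[OF f i] in \<open>auto simp: F_def\<close>)
  define H where "H q = f q + - F q" for q
  have H: "slice_regular H"
    unfolding H_def[abs_def] by (intro slice_regular_add slice_regular_uminus f F)
  obtain J where J: "J \<in> imag_units" "q = slice_pt J (Complex (qre q) (norm (quat_im q)))"
    by (rule quat_on_slice)
  define z where "z = Complex (qre q) (norm (quat_im q))"
  have qz: "q = slice_pt J z" using J by (simp add: z_def)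
  have zb: "z \<in> ball 0 1" using q by (simp add: qz norm_slice_pt[OF J(1)])
  have H0: "H (of_real x) = 0" for x
    using slice_ext_slice_pt[OF J(1), of i "\<lambda>z. f (slice_pt i z)" "of_real x"]
    by (simp add: H_def F_def half_sum_eq)
  have coord0: "slice_coord J (H (slice_pt J z) * a) = 0" for a
  proof (rule analytic_continuation[OF slice_regular_coord_holomorphic[OF H J(1)]])
    show "(of_real ` {-1<..<1} :: complex set) \<subseteq> ball 0 1" by auto
    show "(0::complex) islimpt of_real ` {-1<..<1}"
      unfolding islimpt_approachable
    proof (intro allI impI)
      fix e :: real assume "e > 0"
      then show "\<exists>y\<in>of_real ` {-1<..<1}. y \<noteq> (0::complex) \<and> dist y 0 < e"
        by (intro bexI[of _ "of_real (min (e/2) (1/2))"] imageI) auto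
    qed
  qed (use zb H0 in \<open>auto simp: slice_coord_linear_simps\<close>)
  obtain j where j: "j \<in> imag_units" "j * J = - (J * j)"
    using orthogonal_imag_unit[OF J(1)] .
  have "H q = 0"
    using norm_le_slice_coords[OF J(1) j, of "H q"] coord0[of 1] coord0[of "- j"] by (simp add: qz)
  then show ?thesis by (simp add: H_def F_def)
qed

section \<open>Normal families\<close>

lemma compact_subset_unit_ball:
  fixes K :: "'a::real_normed_vector set"
  assumes "compact K" "K \<subseteq> ball 0 1"
  obtains r where "0 \<le> r" "r < 1" "K \<subseteq> cball 0 r"
proof (cases "K = {}")
  case True
  then show ?thesis using that[of 0] by simp
next
  case False
  obtain x where x: "x \<in> K" "\<And>y. y \<in> K \<Longrightarrow> norm y \<le> norm x"
    using continuous_attains_sup[OF assms(1) False continuous_on_norm_id] by blast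
  then have "norm x < 1" "K \<subseteq> cball 0 (norm x)" using assms(2) by (auto simp: subset_iff)
  then show ?thesis using that[of "norm x"] by simp
qed

lemma uniform_limit_slice:
  assumes i: "i \<in> imag_units" and K: "compact K" "K \<subseteq> ball 0 1"
    and lim: "\<And>K. compact K \<Longrightarrow> K \<subseteq> ball 0 1 \<Longrightarrow> uniform_limit K f g sequentially"
  shows "uniform_limit K (\<lambda>n z. f n (slice_pt i z)) (\<lambda>z. g (slice_pt i z)) sequentially"
proof -
  have "compact (slice_pt i ` K)"
    by (intro compact_continuous_image continuous_intros K)
  moreover have "slice_pt i ` K \<subseteq> ball 0 1" using K i by (auto simp: norm_slice_pt)
  ultimately have "uniform_limit (slice_pt i ` K) f g sequentially" by (rule lim)
  then show ?thesis by (simp add: uniform_limit_iff)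
qed

text \<open>Weierstrass's theorem on derivatives of locally uniform limits, applied to each
  coordinate. Uniqueness of the complex derivative identifies the limit with the derivative of
  \<open>g\<close>.\<close>

lemma real_deriv_tendsto:
  assumes f: "\<And>n. slice_regular (f n)" and g: "slice_regular g"
    and lim: "\<And>K. compact K \<Longrightarrow> K \<subseteq> ball 0 1 \<Longrightarrow> uniform_limit K f g sequentially"
    and i: "i \<in> imag_units" and z: "z \<in> ball 0 1"
  shows "(\<lambda>n. real_deriv (f n) (slice_pt i z)) \<longlonglongrightarrow> real_deriv g (slice_pt i z)"
proof -
  define r where "r = (1 - norm z) / 2"
  have r: "r > 0" using z by (simp add: r_def)
  have sub: "cball z r \<subseteq> ball 0 1"
  proof
    fix w assume "w \<in> cball z r"
    then show "w \<in> ball 0 1"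
      using norm_triangle_sub[of w z] z by (simp add: r_def dist_norm norm_minus_commute)
  qed
  have coord: "(\<lambda>n. slice_coord i (real_deriv (f n) (slice_pt i z) * a)) \<longlonglongrightarrow> slice_coord i (real_deriv g (slice_pt i z) * a)" for a
  proof -
    have ul: "uniform_limit (cball z r) (\<lambda>n z. slice_coord i (f n (slice_pt i z) * a)) (\<lambda>z. slice_coord i (g (slice_pt i z) * a)) sequentially"
      by (intro bounded_linear.uniform_limit[OF bounded_linear_slice_coord]
          bounded_linear.uniform_limit[OF bounded_linear_mult_left] uniform_limit_slice i sub lim) auto
    have ev: "\<forall>\<^sub>F n in sequentially. continuous_on (cball z r) (\<lambda>z. slice_coord i (f n (slice_pt i z) * a)) \<and>
       (\<forall>w\<in>ball z r. ((\<lambda>z. slice_coord i (f n (slice_pt i z) * a)) has_field_derivative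
           slice_coord i (real_deriv (f n) (slice_pt i w) * a)) (at w))"
    proof (intro always_eventually allI conjI ballI)
      fix n
      show "continuous_on (cball z r) (\<lambda>z. slice_coord i (f n (slice_pt i z) * a))"
        by (rule continuous_on_subset[OF holomorphic_on_imp_continuous_on[OF slice_regular_coord_holomorphic[OF f i]] sub])
      fix w assume "w \<in> ball z r"
      then have "w \<in> ball 0 1" using sub ball_subset_cball by blast
      then show "((\<lambda>z. slice_coord i (f n (slice_pt i z) * a)) has_field_derivative
           slice_coord i (real_deriv (f n) (slice_pt i w) * a)) (at w)"
        by (rule slice_regular_coord_derivative[OF f i])
    qed
    obtain g' where "continuous_on (cball z r) (\<lambda>z. slice_coord i (g (slice_pt i z) * a))" and
      *: "\<And>w. w \<in> ball z r \<Longrightarrow> ((\<lambda>z. slice_coord i (g (slice_pt i z) * a)) has_field_derivative g' w) (at w) \<and>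
        (\<lambda>n. slice_coord i (real_deriv (f n) (slice_pt i w) * a)) \<longlonglongrightarrow> g' w"
      by (rule has_complex_derivative_uniform_limit[OF ev ul sequentially_bot r]) (rule that)
    from *[of z] have "((\<lambda>z. slice_coord i (g (slice_pt i z) * a)) has_field_derivative g' z) (at z)"
        "(\<lambda>n. slice_coord i (real_deriv (f n) (slice_pt i z) * a)) \<longlonglongrightarrow> g' z"
      using r by auto
    then show ?thesis
      using DERIV_unique[OF _ slice_regular_coord_derivative[OF g i z]] by metis
  qed
  obtain j where j: "j \<in> imag_units" "j * i = - (i * j)"
    using orthogonal_imag_unit[OF i] .
  have "(\<lambda>n. slice_pt i (slice_coord i (real_deriv (f n) (slice_pt i z) * 1)) + slice_pt i (slice_coord i (real_deriv (f n) (slice_pt i z) * (- j))) * j)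
    \<longlonglongrightarrow> slice_pt i (slice_coord i (real_deriv g (slice_pt i z) * 1)) + slice_pt i (slice_coord i (real_deriv g (slice_pt i z) * (- j))) * j"
    by (intro tendsto_intros coord)
  then show ?thesis
    unfolding mult_1_right by (simp only: slice_decomposition[OF i j, symmetric])
qed

text \<open>The densities converge pointwise with the derivatives, so Fatou's lemma applies on each
  slice. With one bound \<open>B\<close> for all slices the conclusion passes to the
  supremum.\<close>

lemma besov_integral_le_of_limit:
  assumes p: "p > 1" and f: "\<And>n. slice_regular (f n)" and g: "slice_regular g"
    and lim: "\<And>K. compact K \<Longrightarrow> K \<subseteq> ball 0 1 \<Longrightarrow> uniform_limit K f g sequentially"
    and i: "i \<in> imag_units" and le: "\<And>n. besov_integral p (f n) i \<le> B"
  shows "besov_integral p g i \<le> B"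
proof -
  let ?u = "\<lambda>f z. ennreal (besov_density p f i z) * indicator (ball 0 1) z"
  have lim: "liminf (\<lambda>n. ?u (f n) z) = ?u g z" for z
  proof (cases "z \<in> ball 0 1")
    case True
    have "(\<lambda>n. besov_density p (f n) i z) \<longlonglongrightarrow> besov_density p g i z"
      unfolding besov_density_eq[OF True]
      using p by (intro tendsto_intros tendsto_powr2 tendsto_norm real_deriv_tendsto f g lim i True) auto
    then have "(\<lambda>n. ennreal (besov_density p (f n) i z)) \<longlonglongrightarrow> ennreal (besov_density p g i z)"
      by (rule tendsto_ennrealI)
    then show ?thesis using True by (simp add: lim_imp_Liminf)
  qed (simp add: Liminf_const)
  have "besov_integral p g i = (\<integral>\<^sup>+z. liminf (\<lambda>n. ?u (f n) z) \<partial>lborel)"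
    by (simp add: lim besov_integral_eq[OF i])
  also have "\<dots> \<le> liminf (\<lambda>n. \<integral>\<^sup>+z. ?u (f n) z \<partial>lborel)"
    using besov_density_measurable[OF f i] p by (intro nn_integral_liminf) auto
  also have "\<dots> \<le> liminf (\<lambda>n. B)"
    using le by (intro Liminf_mono) (simp add: besov_integral_eq[OF i])
  also have "\<dots> = B" by (simp add: Liminf_const)
  finally show ?thesis .
qed

lemma slice_pt_combination_has_derivative:
  assumes i: "i \<in> imag_units"
    and "(F has_field_derivative F') (at z)" "(G has_field_derivative G') (at z)"
  shows "((\<lambda>z. slice_pt i (F z) + slice_pt i (G z) * j) has_derivative
    (\<lambda>w. slice_pt i w * (slice_pt i F' + slice_pt i G' * j))) (at z)"
proof -
  have "((\<lambda>z. slice_pt i (F z) + slice_pt i (G z) * j) has_derivative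
    (\<lambda>w. slice_pt i (F' * w) + slice_pt i (G' * w) * j)) (at z)"
    using assms(2,3) unfolding has_field_derivative_def
    by (intro has_derivative_add has_derivative_mult_left bounded_linear.has_derivative[OF bounded_linear_slice_pt])
  moreover have "slice_pt i (F' * w) + slice_pt i (G' * w) * j = slice_pt i w * (slice_pt i F' + slice_pt i G' * j)" for w
    by (simp add: mult.commute[of F'] mult.commute[of G'] slice_pt_mult[OF i] distrib_left mult.assoc)
  ultimately show ?thesis by simp
qed

lemma besov_Montel:
  assumes p: "p > 1" and bdd: "besov_bounded p (range f)"
  obtains r g where "strict_mono (r :: nat \<Rightarrow> nat)" "g \<in> besov p"
    "\<And>K. compact K \<Longrightarrow> K \<subseteq> ball 0 1 \<Longrightarrow> uniform_limit K (\<lambda>n. f (r n)) g sequentially"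
proof -
  obtain M where M: "\<And>n. f n \<in> besov p" "\<And>n. besov_norm p (f n) \<le> M"
    using bdd by (auto simp: besov_bounded_def)
  have reg: "slice_regular (f n)" for n using M(1) by (simp add: besov_def)
  obtain i where i: "i \<in> imag_units" using imag_units_nonempty by blast
  obtain j where j: "j \<in> imag_units" "j * i = - (i * j)"
    using orthogonal_imag_unit[OF i] .
  define A where "A a n z = slice_coord i (f n (slice_pt i z) * a)" for a n z
  have holA: "A a n holomorphic_on ball 0 1" for a n
    unfolding A_def[abs_def] by (rule slice_regular_coord_holomorphic[OF reg i])
  have bddA: "\<exists>B. \<forall>h\<in>range (A a). \<forall>z\<in>K. norm (h z) \<le> B" if K: "compact K" "K \<subseteq> ball 0 1" for a K
  proof -
    obtain \<rho> where \<rho>: "0 \<le> \<rho>" "\<rho> < 1" "K \<subseteq> cball 0 \<rho>"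
      using compact_subset_unit_ball[OF K] .
    obtain C where C: "C \<ge> 0" "\<And>f q. f \<in> besov p \<Longrightarrow> q \<in> cball 0 \<rho> \<Longrightarrow> norm (f q) \<le> C * besov_norm p f"
      by (rule besov_bound[OF p \<rho>(1,2)]) (rule that)
    have "norm (A a n z) \<le> C * M * norm a" if z: "z \<in> K" for n z
    proof -
      have "slice_pt i z \<in> cball 0 \<rho>" using z \<rho>(3) by (auto simp: norm_slice_pt[OF i])
      then have "norm (f n (slice_pt i z)) \<le> C * M"
        using C M by (meson mult_left_mono order_trans)
      then have "norm (f n (slice_pt i z)) * norm a \<le> C * M * norm a"
        by (rule mult_right_mono) simp
      then show ?thesis
        using norm_slice_coord_le[OF i, of "f n (slice_pt i z) * a"] by (simp add: A_def norm_mult)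
    qed
    then show ?thesis by blast
  qed
  obtain F r1 where F: "F holomorphic_on ball 0 1" "strict_mono (r1 :: nat \<Rightarrow> nat)"
    "\<And>K. compact K \<Longrightarrow> K \<subseteq> ball 0 1 \<Longrightarrow> uniform_limit K (A 1 \<circ> r1) F sequentially"
    by (rule Montel[OF open_ball _ bddA[of _ 1] order_refl]) (use holA in auto)
  \<comment> \<open>The second extraction runs along \<open>r1\<close>, so that both coordinates
    converge along \<open>r1 \<circ> r2\<close>.\<close>
  obtain G r2 where G: "G holomorphic_on ball 0 1" "strict_mono (r2 :: nat \<Rightarrow> nat)"
    "\<And>K. compact K \<Longrightarrow> K \<subseteq> ball 0 1 \<Longrightarrow> uniform_limit K ((A (- j) \<circ> r1) \<circ> r2) G sequentially"
    by (rule Montel[OF open_ball _ bddA[of _ "- j"], where \<F> = "A (- j) \<circ> r1"]) (use holA in auto)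
  define r where "r = r1 \<circ> r2"
  have r: "strict_mono r" unfolding r_def using F(2) G(2) by (rule strict_mono_o)
  have limF: "uniform_limit K (\<lambda>n. A 1 (r n)) F sequentially" if "compact K" "K \<subseteq> ball 0 1" for K
    using filterlim_compose[OF F(3)[OF that] filterlim_subseq[OF G(2)]] by (simp add: r_def o_def)
  have limG: "uniform_limit K (\<lambda>n. A (- j) (r n)) G sequentially" if "compact K" "K \<subseteq> ball 0 1" for K
    using G(3)[OF that] by (simp add: r_def o_def)
  define g0 where "g0 z = slice_pt i (F z) + slice_pt i (G z) * j" for z
  have fA: "f n (slice_pt i z) = slice_pt i (A 1 n z) + slice_pt i (A (- j) n z) * j" for n z
    using slice_decomposition[OF i j, of "f n (slice_pt i z)"] by (simp add: A_def)
  have lim0: "uniform_limit K (\<lambda>n z. f (r n) (slice_pt i z)) g0 sequentially" if "compact K" "K \<subseteq> ball 0 1" for K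
    unfolding fA g0_def[abs_def]
    by (intro uniform_limit_add bounded_linear.uniform_limit[OF bounded_linear_mult_left]
        bounded_linear.uniform_limit[OF bounded_linear_slice_pt] limF limG that)
  define g where "g q = (if q \<in> ball 0 1 then slice_ext i g0 q else 0)" for q
  have g: "slice_regular g"
  proof (rule slice_regular_slice_ext[OF i])
    fix z :: complex assume z: "z \<in> ball 0 1"
    have "(F has_field_derivative deriv F z) (at z)" "(G has_field_derivative deriv G z) (at z)"
      using F(1) G(1) z by (auto intro: holomorphic_derivI)
    from slice_pt_combination_has_derivative[OF i this]
    show "\<exists>c. (g0 has_derivative (\<lambda>w. slice_pt i w * c)) (at z)"
      unfolding g0_def[abs_def] by blast
  qed (simp add: g_def)
  have lim: "uniform_limit K (\<lambda>n. f (r n)) g sequentially" if K: "compact K" "K \<subseteq> ball 0 1" for K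
    unfolding uniform_limit_iff
  proof (intro allI impI)
    fix e :: real assume e: "e > 0"
    obtain \<rho> where \<rho>: "0 \<le> \<rho>" "\<rho> < 1" "K \<subseteq> cball 0 \<rho>"
      using compact_subset_unit_ball[OF K] .
    \<comment> \<open>The formula evaluates at the two slice points with the real part and the
      modulus of \<open>q\<close>. These may lie outside \<open>K\<close>, hence the closed disk.
      Each enters with a coefficient of norm at most 1, hence \<open>e / 2\<close>.\<close>
    have "uniform_limit (cball 0 \<rho>) (\<lambda>n z. f (r n) (slice_pt i z)) g0 sequentially"
      using \<rho> by (intro lim0) auto
    then have "\<forall>\<^sub>F n in sequentially. \<forall>z\<in>cball 0 \<rho>. dist (f (r n) (slice_pt i z)) (g0 z) < e / 2"
      using e unfolding uniform_limit_iff by (meson half_gt_zero)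
    then show "\<forall>\<^sub>F n in sequentially. \<forall>q\<in>K. dist (f (r n) q) (g q) < e"
    proof (rule eventually_mono, intro ballI)
      fix n q assume n: "\<forall>z\<in>cball 0 \<rho>. dist (f (r n) (slice_pt i z)) (g0 z) < e / 2" and q: "q \<in> K"
      have qb: "q \<in> ball 0 1" using q K by auto
      have "norm q \<le> \<rho>" using q \<rho>(3) by auto
      have "f (r n) q - g q = slice_ext i (\<lambda>z. f (r n) (slice_pt i z) - g0 z) q"
        using slice_representation[OF reg i qb, of "r n"] qb by (simp add: g_def slice_ext_diff)
      then have "dist (f (r n) q) (g q) \<le> dist (f (r n) (slice_pt i (Complex (qre q) (norm (quat_im q))))) (g0 (Complex (qre q) (norm (quat_im q))))
         + dist (f (r n) (slice_pt i (Complex (qre q) (- norm (quat_im q))))) (g0 (Complex (qre q) (- norm (quat_im q))))"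
        using norm_slice_ext_le[OF i, of "\<lambda>z. f (r n) (slice_pt i z) - g0 z" q] by (simp add: dist_norm)
      also have "\<dots> < e / 2 + e / 2"
        using n \<open>norm q \<le> \<rho>\<close> by (intro add_strict_mono) (auto simp: norm_Complex_qre_quat_im)
      finally show "dist (f (r n) q) (g q) < e" by simp
    qed
  qed
  have "besov_integral p g k \<le> ennreal ((M + 1) powr p)" if k: "k \<in> imag_units" for k
  proof (rule besov_integral_le_of_limit[OF p reg g lim k])
    fix n
    \<comment> \<open>\<open>M + 1\<close> instead of \<open>M\<close> supplies the strict
      inequality that \<open>besov_sup_le_powr\<close> requires.\<close>
    have "besov_norm p (f (r n)) - norm (f (r n) 0) < M + 1"
      using M(2)[of "r n"] norm_ge_zero[of "f (r n) 0"] by linarith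
    then show "besov_integral p (f (r n)) k \<le> ennreal ((M + 1) powr p)"
      using p M(1) by (intro order_trans[OF besov_integral_le_sup[OF k] besov_sup_le_powr]) auto
  qed
  then have "besov_sup p g \<le> ennreal ((M + 1) powr p)"
    unfolding besov_sup_def by (rule SUP_least)
  then have "g \<in> besov p"
    using g by (auto simp: besov_def g_def intro: le_less_trans)
  from that[OF r this lim] show ?thesis .
qed

section \<open>Compactness of composition operators\<close>

lemma slice_comp_add:
  "slice_comp i \<Phi> (\<lambda>q. f q + g q) = (\<lambda>q. slice_comp i \<Phi> f q + slice_comp i \<Phi> g q)"
  by (auto simp: slice_comp_eq_slice_ext slice_ext_add)

lemma slice_comp_diff:
  "slice_comp i \<Phi> (\<lambda>q. f q - g q) = (\<lambda>q. slice_comp i \<Phi> f q - slice_comp i \<Phi> g q)"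
  by (auto simp: slice_comp_eq_slice_ext slice_ext_diff)

lemma slice_comp_mult_right:
  "slice_comp i \<Phi> (\<lambda>q. f q * a) = (\<lambda>q. slice_comp i \<Phi> f q * a)"
  by (auto simp: slice_comp_eq_slice_ext slice_ext_mult_right)

text \<open>The value at \<open>q\<close> involves \<open>f m\<close> at two points only, both in
  the ball, so pointwise convergence is enough.\<close>

lemma slice_comp_tendsto_zero:
  assumes i: "i \<in> imag_units" and \<Phi>: "\<Phi> ` ball 0 1 \<subseteq> ball 0 1"
    and lim: "\<And>q. q \<in> ball 0 1 \<Longrightarrow> (\<lambda>m. f m q) \<longlonglongrightarrow> (0 :: quat)"
  shows "(\<lambda>m. slice_comp i \<Phi> (f m) q) \<longlonglongrightarrow> 0"
proof (cases "q \<in> ball 0 1")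
  case True
  let ?z = "Complex (qre q) (norm (quat_im q))" and ?w = "Complex (qre q) (- norm (quat_im q))"
  have "\<Phi> (slice_pt i ?z) \<in> ball 0 1" "\<Phi> (slice_pt i ?w) \<in> ball 0 1"
    by (rule bspec[OF \<Phi>[unfolded image_subset_iff]];
        use True in \<open>simp add: norm_slice_pt[OF i] norm_Complex_qre_quat_im\<close>)+
  then have "(\<lambda>m. f m (\<Phi> (slice_pt i ?z))) \<longlonglongrightarrow> 0" "(\<lambda>m. f m (\<Phi> (slice_pt i ?w))) \<longlonglongrightarrow> 0"
    by (auto intro: lim)
  then have "(\<lambda>m. slice_ext i (\<lambda>z. f m (\<Phi> (slice_pt i z))) q) \<longlonglongrightarrow>
      (1 / 2) *\<^sub>R ((1 - quat_im q /\<^sub>R norm (quat_im q) * i) * 0 + (1 + quat_im q /\<^sub>R norm (quat_im q) * i) * 0)"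
    unfolding slice_ext_def by (intro tendsto_intros)
  then show ?thesis using True by (simp add: slice_comp_eq_slice_ext)
qed (simp add: slice_comp_eq_slice_ext)

lemma besov_norm_tendsto_imp_pointwise:
  assumes p: "p > 1" and f: "\<And>n. f n \<in> besov p" and lim: "(\<lambda>n. besov_norm p (f n)) \<longlonglongrightarrow> 0"
  shows "(\<lambda>n. f n q) \<longlonglongrightarrow> 0"
proof (cases "q \<in> ball 0 1")
  case True
  then have "norm q < 1" by simp
  obtain C where C: "\<And>f q'. f \<in> besov p \<Longrightarrow> q' \<in> cball 0 (norm q) \<Longrightarrow> norm (f q') \<le> C * besov_norm p f"
    by (rule besov_bound[OF p norm_ge_zero \<open>norm q < 1\<close>]) (rule that)
  have "(\<lambda>n. C * besov_norm p (f n)) \<longlonglongrightarrow> 0"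
    using tendsto_mult_left[OF lim, of C] by simp
  then show ?thesis
    by (rule Lim_null_comparison[rotated]) (use C f in \<open>auto intro!: always_eventually\<close>)
next
  case False
  then have "f n q = 0" for n using f[of n] by (simp add: besov_def)
  then show ?thesis by simp
qed

lemma not_tendsto_zero_subsequence:
  fixes x :: "nat \<Rightarrow> real"
  assumes "\<not> x \<longlonglongrightarrow> 0"
  obtains e s where "e > 0" "strict_mono (s :: nat \<Rightarrow> nat)" "\<And>n. \<bar>x (s n)\<bar> \<ge> e"
proof -
  obtain e where e: "e > 0" "\<not> (\<forall>\<^sub>F n in sequentially. \<bar>x n\<bar> < e)"
    using assms by (auto simp: tendsto_iff)
  then have "infinite {n. \<bar>x n\<bar> \<ge> e}"
    by (simp add: cofinite_eq_sequentially[symmetric] eventually_cofinite not_less)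
  then obtain s where "strict_mono (s :: nat \<Rightarrow> nat)" "\<And>n. s n \<in> {n. \<bar>x n\<bar> \<ge> e}"
    using infinite_enumerate by blast
  then show ?thesis using that[OF e(1)] by auto
qed

lemma compact_imp_norm_tendsto_zero:
  assumes p: "p > 1" and i: "i \<in> imag_units" and \<Phi>: "\<Phi> ` ball 0 1 \<subseteq> ball 0 1"
    and comp: "besov_compact_operator p (slice_comp i \<Phi>)"
    and bdd: "besov_bounded p (range f)"
    and lim: "\<And>K. compact K \<Longrightarrow> K \<subseteq> ball 0 1 \<Longrightarrow> uniform_limit K f (\<lambda>_. 0) sequentially"
  shows "slice_comp i \<Phi> (f m) \<in> besov p" "(\<lambda>m. besov_norm p (slice_comp i \<Phi> (f m))) \<longlonglongrightarrow> 0"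
proof -
  interpret B: Metric_space "besov p" "\<lambda>f g. besov_norm p (\<lambda>q. f q - g q)"
    by (rule Metric_space_besov[OF p])
  define T where "T = slice_comp i \<Phi>"
  have fb: "f n \<in> besov p" for n using bdd by (auto simp: besov_bounded_def)
  have T: "T g \<in> besov p" if "g \<in> besov p" for g
    using comp that by (auto simp: besov_compact_operator_def T_def)
  show "slice_comp i \<Phi> (f m) \<in> besov p" using T[OF fb] by (simp add: T_def)
  define S where "S = B.mtopology closure_of (T ` range f)"
  have cpt: "compactin B.mtopology S"
    using comp bdd by (simp add: besov_compact_operator_def besov_topology_def S_def T_def)
  have TS: "T (f n) \<in> S" for n
    unfolding S_def using T[OF fb] by (intro subsetD[OF closure_of_subset]) auto
  have "(\<lambda>m. besov_norm p (T (f m))) \<longlonglongrightarrow> 0"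
  proof (rule ccontr)
    assume "\<not> ?thesis"
    then obtain e s where e: "e > 0" "strict_mono (s :: nat \<Rightarrow> nat)" "\<And>n. \<bar>besov_norm p (T (f (s n)))\<bar> \<ge> e"
      by (rule not_tendsto_zero_subsequence) blast
    \<comment> \<open>All terms of this subsequence have norm at least \<open>e\<close>, and so do
      those of any further subsequence; a norm limit 0 is then impossible.\<close>
    have "range (\<lambda>n. T (f (s n))) \<subseteq> S" using TS by auto
    then obtain l r where l: "l \<in> S" "strict_mono (r :: nat \<Rightarrow> nat)"
      "limitin B.mtopology ((\<lambda>n. T (f (s n))) \<circ> r) l sequentially"
      using cpt unfolding B.compactin_sequentially by blast
    have lb: "l \<in> besov p" and d: "(\<lambda>n. besov_norm p (\<lambda>q. T (f (s (r n))) q - l q)) \<longlonglongrightarrow> 0"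
      using l(3) by (auto simp: B.limitin_metric_dist_null o_def)
    have l0: "l q = 0" for q
    proof -
      have "(\<lambda>n. T (f (s (r n))) q - l q) \<longlonglongrightarrow> 0"
        by (rule besov_norm_tendsto_imp_pointwise[OF p besov_diff(1)[OF p T[OF fb] lb] d])
      moreover have "(\<lambda>n. T (f (s (r n))) q) \<longlonglongrightarrow> 0"
      proof -
        have "(\<lambda>m. f m q) \<longlonglongrightarrow> 0" if "q \<in> ball 0 1" for q
          using tendsto_uniform_limitI[OF lim[of "{q}"], of q] that by simp
        then have "(\<lambda>m. T (f m) q) \<longlonglongrightarrow> 0"
          unfolding T_def by (rule slice_comp_tendsto_zero[OF i \<Phi>])
        from LIMSEQ_subseq_LIMSEQ[OF this strict_mono_o[OF e(2) l(2)]] show ?thesis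
          by (simp add: o_def)
      qed
      ultimately have "(\<lambda>n. T (f (s (r n))) q - (T (f (s (r n))) q - l q)) \<longlonglongrightarrow> 0 - 0"
        by (intro tendsto_diff)
      then show ?thesis by (simp add: LIMSEQ_const_iff)
    qed
    then have "(\<lambda>n. besov_norm p (T (f (s (r n))))) \<longlonglongrightarrow> 0" using d by simp
    then have "\<forall>\<^sub>F n in sequentially. \<bar>besov_norm p (T (f (s (r n))))\<bar> < e"
      using e(1) by (simp add: tendsto_iff)
    then have "\<forall>\<^sub>F n::nat in sequentially. False"
      by (rule eventually_mono) (use e(3) in \<open>auto simp: not_less[symmetric]\<close>)
    then show False by simp
  qed
  then show "(\<lambda>m. besov_norm p (slice_comp i \<Phi> (f m))) \<longlonglongrightarrow> 0" by (simp add: T_def)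
qed

lemma norm_tendsto_zero_imp_compact:
  assumes p: "p > 1"
    and H: "\<And>f. besov_bounded p (range f) \<Longrightarrow>
      (\<And>K. compact K \<Longrightarrow> K \<subseteq> ball 0 1 \<Longrightarrow> uniform_limit K f (\<lambda>_. 0) sequentially) \<Longrightarrow>
      (\<forall>m::nat. slice_comp i \<Phi> (f m) \<in> besov p) \<and> (\<lambda>m. besov_norm p (slice_comp i \<Phi> (f m))) \<longlonglongrightarrow> 0"
  shows "besov_compact_operator p (slice_comp i \<Phi>)"
proof -
  interpret B: Metric_space "besov p" "\<lambda>f g. besov_norm p (\<lambda>q. f q - g q)"
    by (rule Metric_space_besov[OF p])
  define T where "T = slice_comp i \<Phi>"
  have T: "T g \<in> besov p" if g: "g \<in> besov p" for g
  proof -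
    define f where "f n = (if n = 0 then g else (\<lambda>_. 0))" for n :: nat
    have "range f \<subseteq> {g, \<lambda>_. 0}" by (auto simp: f_def)
    then have "besov_bounded p (range f)"
      using g unfolding besov_bounded_def
      by (auto simp: f_def besov_zero intro!: exI[of _ "besov_norm p g"] besov_norm_nonneg)
    moreover have "uniform_limit K f (\<lambda>_. 0) sequentially" for K
      unfolding uniform_limit_iff eventually_sequentially by (auto simp: f_def intro!: exI[of _ 1])
    ultimately have "slice_comp i \<Phi> (f 0) \<in> besov p" using H by blast
    then show ?thesis by (simp add: f_def T_def)
  qed
  \<comment> \<open>The limit is sought in the whole space and need not lie in the image of
    \<open>A\<close>, because only the closure of the image has to be compact.\<close>
  have subseq: "\<exists>l r. l \<in> besov p \<and> strict_mono (r :: nat \<Rightarrow> nat) \<and> limitin B.mtopology (\<sigma> \<circ> r) l sequentially"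
    if A: "besov_bounded p A" and \<sigma>: "range \<sigma> \<subseteq> T ` A" for A and \<sigma> :: "nat \<Rightarrow> quat \<Rightarrow> quat"
  proof -
    have "\<forall>n. \<exists>h. h \<in> A \<and> \<sigma> n = T h" using \<sigma> by blast
    then obtain f where f: "\<And>n. f n \<in> A" "\<And>n. \<sigma> n = T (f n)" by metis
    obtain M where M: "\<And>n. f n \<in> besov p" "\<And>n. besov_norm p (f n) \<le> M"
      using A f(1) by (auto simp: besov_bounded_def)
    then have "besov_bounded p (range f)" by (auto simp: besov_bounded_def)
    from besov_Montel[OF p this] obtain r g where r: "strict_mono (r :: nat \<Rightarrow> nat)" and g: "g \<in> besov p"
      and lim: "\<And>K. compact K \<Longrightarrow> K \<subseteq> ball 0 1 \<Longrightarrow> uniform_limit K (\<lambda>n. f (r n)) g sequentially"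
      by metis
    define h where "h n q = f (r n) q - g q" for n q
    have "besov_bounded p (range h)"
      unfolding besov_bounded_def
    proof (intro conjI exI[of _ "M + besov_norm p g"] ballI subsetI)
      fix u assume "u \<in> range h"
      then obtain n where u: "u = (\<lambda>q. f (r n) q - g q)" by (auto simp: h_def[abs_def])
      show "u \<in> besov p" unfolding u by (rule besov_diff(1)[OF p M(1) g])
      show "besov_norm p u \<le> M + besov_norm p g"
        unfolding u using besov_diff(2)[OF p M(1)[of "r n"] g] M(2)[of "r n"] by linarith
    qed
    moreover have "uniform_limit K h (\<lambda>_. 0) sequentially" if "compact K" "K \<subseteq> ball 0 1" for K
      using lim[OF that] by (simp add: uniform_limit_iff h_def dist_norm)
    ultimately have "(\<lambda>n. besov_norm p (slice_comp i \<Phi> (h n))) \<longlonglongrightarrow> 0" using H by blast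
    \<comment> \<open>Composition is additive in the outer function, so the norm of the image of
      \<open>h n\<close> is the distance between the images of \<open>f (r n)\<close> and
      \<open>g\<close>.\<close>
    moreover have "slice_comp i \<Phi> (h n) = (\<lambda>q. T (f (r n)) q - T g q)" for n
      unfolding h_def[abs_def] slice_comp_diff T_def ..
    ultimately have "(\<lambda>n. besov_norm p (\<lambda>q. T (f (r n)) q - T g q)) \<longlonglongrightarrow> 0" by simp
    then have "limitin B.mtopology (\<sigma> \<circ> r) (T g) sequentially"
      using T M(1) g by (simp add: B.limitin_metric_dist_null o_def f(2))
    then show ?thesis using r T[OF g] by blast
  qed
  have "compactin (besov_topology p) (besov_topology p closure_of (T ` A))" if A: "besov_bounded p A" for A
  proof -
    have TA: "T ` A \<subseteq> besov p" using A T by (auto simp: besov_bounded_def)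
    \<comment> \<open>The Bolzano-Weierstrass property relative to the ambient space translates
      convergent subsequences into compactness of the closure.\<close>
    have "\<forall>\<sigma>::nat \<Rightarrow> quat \<Rightarrow> quat. range \<sigma> \<subseteq> T ` A \<longrightarrow>
        (\<exists>l r. l \<in> besov p \<and> strict_mono r \<and> limitin B.mtopology (\<sigma> \<circ> r) l sequentially)"
      using subseq[OF A] by blast
    then have "\<forall>X. X \<subseteq> T ` A \<and> infinite X \<longrightarrow> besov p \<inter> B.mtopology derived_set_of X \<noteq> {}"
      by (rule iffD1[OF B.Bolzano_Weierstrass_property[OF TA TA]])
    then show ?thesis
      unfolding besov_topology_def B.compact_closure_of_eq_Bolzano_Weierstrass by blast
  qed
  then show ?thesis
    unfolding besov_compact_operator_def T_def[symmetric]
    using T by (auto simp: T_def slice_comp_add slice_comp_mult_right)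
qed

theorem proposition3p3:
  fixes p :: real and \<Phi> :: "quat \<Rightarrow> quat" and i :: quat
  assumes "p > 1"
    and "slice_regular \<Phi>" and "\<Phi> ` ball 0 1 \<subseteq> ball 0 1"
    and "i \<in> imag_units" and "\<Phi> ` slice_ball i \<subseteq> slice_ball i"
  shows "besov_compact_operator p (slice_comp i \<Phi>) \<longleftrightarrow>
    (\<forall>f :: nat \<Rightarrow> quat \<Rightarrow> quat.
       besov_bounded p (range f) \<longrightarrow>
       (\<forall>K. compact K \<and> K \<subseteq> ball 0 1 \<longrightarrow> uniform_limit K f (\<lambda>_. 0) sequentially) \<longrightarrow>
       (\<forall>m. slice_comp i \<Phi> (f m) \<in> besov p) \<and>
       (\<lambda>m. besov_norm p (slice_comp i \<Phi> (f m))) \<longlonglongrightarrow> 0)"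
    (is "?compact \<longleftrightarrow> (\<forall>f. ?bdd f \<longrightarrow> ?lim f \<longrightarrow> ?concl f)")
proof
  assume c: ?compact
  show "\<forall>f. ?bdd f \<longrightarrow> ?lim f \<longrightarrow> ?concl f"
  proof (intro allI impI)
    fix f assume b: "?bdd f" and l: "?lim f"
    from compact_imp_norm_tendsto_zero[OF assms(1,4,3) c b] l show "?concl f" by blast
  qed
next
  assume *: "\<forall>f. ?bdd f \<longrightarrow> ?lim f \<longrightarrow> ?concl f"
  show ?compact
  proof (rule norm_tendsto_zero_imp_compact[OF assms(1)])
    fix f assume "?bdd f" "\<And>K. compact K \<Longrightarrow> K \<subseteq> ball 0 1 \<Longrightarrow> uniform_limit K f (\<lambda>_. 0) sequentially"
    then show "?concl f" using * by blast
  qed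
qed

end
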